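(* Let $A$ be a $\Bbbk$-algebra, let $n\geq 1$ be an integer, and let $\{\!\{-,-\}\!\}:A\times A\to A\otimes A$ be a double $(12)$-weak Poisson bracket associated with the right bimodule structure. Then the unique antisymmetric biderivation $\{-,-\}$ on $\Bbbk[\operatorname{Rep}(A,n)]$ satisfying $$\{a_{ij},b_{kl}\}=\{\!\{a,b\}\!\}'_{ij}\,\{\!\{a,b\}\!\}''_{kl}\,,\qquad a,b\in A,\ 1\leq i,j,k,l\leq n,$$ is a Poisson bracket. Furthermore, this Poisson bracket descends (i.e. restricts) to the ring of trace functions $\Bbbk[\operatorname{Rep}(A,n)]^{\operatorname{tr}}$.
   Context: $\Bbbk$ is a field of characteristic $0$, $\otimes=\otimes_\Bbbk$, and all algebras are unital, associative, finitely generated $\Bbbk$-algebras. An element $d\in A\otimes A$ is written $d=d'\otimes d''$ (Sweedler notation, sum suppressed), and $d^\circ=d''\otimes d'$. The symmetric group $S_m$ acts on $A^{\otimes m}$ by $\tau_\sigma(a_1\otimes\cdots\otimes a_m)=a_{\sigma^{-1}(1)}\otimes\cdots\otimes a_{\sigma^{-1}(m)}$. A double bracket on $A$ associated with the right bimodule structure is a $\Bbbk$-bilinear map $\{\!\{-,-\}\!\}:A\times A\to A\otimes A$ such that for all $a,b,c\in A$: $\{\!\{a,b\}\!\}=-\{\!\{b,a\}\!\}^\circ$; $\{\!\{a,bc\}\!\}=\{\!\{a,c\}\!\}'\otimes b\{\!\{a,c\}\!\}''+\{\!\{a,b\}\!\}'\otimes\{\!\{a,b\}\!\}''c$; $\{\!\{bc,a\}\!\}=b\{\!\{c,a\}\!\}'\otimes\{\!\{c,a\}\!\}''+\{\!\{b,a\}\!\}'c\otimes\{\!\{b,a\}\!\}''$.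 Put $\{\!\{a,b_1\otimes b_2\}\!\}_L=\{\!\{a,b_1\}\!\}\otimes b_2\in A^{\otimes 3}$ (extended linearly). The double Jacobiator is $\{\!\{a,b,c\}\!\}=\{\!\{a,\{\!\{b,c\}\!\}\}\!\}_L+\tau_{(123)}\{\!\{b,\{\!\{c,a\}\!\}\}\!\}_L+\tau_{(132)}\{\!\{c,\{\!\{a,b\}\!\}\}\!\}_L$. The double bracket is called $(12)$-weak Poisson if the $(12)$-weak double Jacobiator $\{\!\{a,b,c\}\!\}-\tau_{(12)}\{\!\{b,a,c\}\!\}$ vanishes for all $a,b,c\in A$. $\Bbbk[\operatorname{Rep}(A,n)]$ is the commutative $\Bbbk$-algebra generated by symbols $a_{ij}$ ($a\in A$, $1\leq i,j\leq n$) subject to $\lambda a_{ij}+\mu b_{ij}=(\lambda a+\mu b)_{ij}$, $1_{ij}=\delta_{ij}$, $(ab)_{ij}=\sum_{k=1}^n a_{ik}b_{kj}$ for $a,b\in A$, $\lambda,\mu\in\Bbbk$. For $a \in A$, $\mathtt{X}(a)=(a_{ij})_{i,j}$ is the matrix with entries $a_{ij}$, and $\Bbbk[\operatorname{Rep}(A,n)]^{\operatorname{tr}}$ is the subalgebra generated by $\operatorname{tr}\mathtt{X}(a)=\sum_i a_{ii}$, $a\in A$. It is known that the antisymmetric biderivation in the statement exists and is unique for any double bracket associated with the right bimodule structure. *)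

theory Defs
  imports
    "HOL-Library.Poly_Mapping"
    "HOL-Library.Set_Algebras"
    "HOL-Combinatorics.Cycles"
    "HOL-Algebra.Generated_Rings"
    "HOL-Algebra.Algebraic_Closure_Type"
begin

text \<open>The sort \<open>{ring, monoid_mult}\<close> is that of unital associative rings. Unlike \<open>ring_1\<close> it
  does not impose \<open>0 \<noteq> 1\<close>, so the zero algebra is included.\<close>

locale k_algebra = vector_space scale
  for scale :: "'k::field \<Rightarrow> 'a::{ring, monoid_mult} \<Rightarrow> 'a" +
  assumes scale_mult_left: "scale c x * y = scale c (x * y)"
    and scale_mult_right: "x * scale c y = scale c (x * y)"

definition is_subalgebra :: "('k \<Rightarrow> 'a \<Rightarrow> 'a) \<Rightarrow> 'a::{ring, monoid_mult} set \<Rightarrow> bool" where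
  "is_subalgebra scale B \<longleftrightarrow>
     0 \<in> B \<and> 1 \<in> B \<and> (\<forall>x\<in>B. \<forall>y\<in>B. x + y \<in> B \<and> x * y \<in> B) \<and> (\<forall>c. \<forall>x\<in>B. scale c x \<in> B)"

definition finitely_generated :: "('k \<Rightarrow> 'a \<Rightarrow> 'a::{ring, monoid_mult}) \<Rightarrow> bool" where
  "finitely_generated scale \<longleftrightarrow> (\<exists>S. finite S \<and> is_subalgebra scale hull S = UNIV)"

text \<open>The free \<open>'k\<close>-vector space on \<open>'x\<close> is \<open>'x \<Rightarrow>\<^sub>0 'k\<close>. An element of its quotient by a subspace
  \<open>N\<close> is a coset \<open>u +o N\<close>; the sum of two cosets is their elementwise sum, the negative of a
  coset is its image under \<open>uminus\<close>, and the zero coset is \<open>N\<close>. A scalar multiple is not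
  the plain image, because scaling by \<open>0\<close> would give \<open>{0}\<close> instead of \<open>N\<close>.\<close>

definition free_scale :: "'k::field \<Rightarrow> ('x \<Rightarrow>\<^sub>0 'k) \<Rightarrow> ('x \<Rightarrow>\<^sub>0 'k)" where
  "free_scale c = Poly_Mapping.map ((*) c)"

definition coset_scale :: "('x \<Rightarrow>\<^sub>0 'k) set \<Rightarrow> 'k::field \<Rightarrow> ('x \<Rightarrow>\<^sub>0 'k) set \<Rightarrow> ('x \<Rightarrow>\<^sub>0 'k) set" where
  "coset_scale N c C = (\<Union>u\<in>C. free_scale c u +o N)"

text \<open>\<open>lin_extend N g\<close> is the linear extension of \<open>g\<close> from generators to a quotient of the free
  vector space on them, \<open>g\<close> taking values in cosets of \<open>N\<close>. When \<open>g\<close> respects the relations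
  of the source, all \<open>u\<close> in the coset \<open>U\<close> contribute the same coset of \<open>N\<close> to the union. The
  summand \<open>N\<close> only matters for the empty sum. For \<open>U\<close> in \<open>A \<otimes> A\<close> this is Sweedler notation:
  \<open>lin_extend N (\<lambda>(x, y). g x y) d\<close> is \<open>g d' d''\<close>.\<close>

definition lin_extend ::
  "('y \<Rightarrow>\<^sub>0 'k) set \<Rightarrow> ('x \<Rightarrow> ('y \<Rightarrow>\<^sub>0 'k::field) set) \<Rightarrow> ('x \<Rightarrow>\<^sub>0 'k) set \<Rightarrow> ('y \<Rightarrow>\<^sub>0 'k) set" where
  "lin_extend N g U =
     (\<Union>u\<in>U. (\<Sum>x\<in>Poly_Mapping.keys u. coset_scale N (Poly_Mapping.lookup u x) (g x)) + N)"

definition rel2 :: "('k \<Rightarrow> 'a \<Rightarrow> 'a) \<Rightarrow> ('a::ring \<times> 'a \<Rightarrow>\<^sub>0 'k::field) set" where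
  "rel2 scale = Modules.module.span free_scale
     ({Poly_Mapping.single (a + a', b) 1 - Poly_Mapping.single (a, b) 1
         - Poly_Mapping.single (a', b) 1 | a a' b. True}
    \<union> {Poly_Mapping.single (a, b + b') 1 - Poly_Mapping.single (a, b) 1
         - Poly_Mapping.single (a, b') 1 | a b b'. True}
    \<union> {Poly_Mapping.single (scale c a, b) 1 - Poly_Mapping.single (a, b) c | c a b. True}
    \<union> {Poly_Mapping.single (a, scale c b) 1 - Poly_Mapping.single (a, b) c | c a b. True})"

definition rel3 :: "('k \<Rightarrow> 'a \<Rightarrow> 'a) \<Rightarrow> ('a::ring \<times> 'a \<times> 'a \<Rightarrow>\<^sub>0 'k::field) set" where
  "rel3 scale = Modules.module.span free_scale
     ({Poly_Mapping.single (a + a', b, c) 1 - Poly_Mapping.single (a, b, c) 1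
         - Poly_Mapping.single (a', b, c) 1 | a a' b c. True}
    \<union> {Poly_Mapping.single (a, b + b', c) 1 - Poly_Mapping.single (a, b, c) 1
         - Poly_Mapping.single (a, b', c) 1 | a b b' c. True}
    \<union> {Poly_Mapping.single (a, b, c + c') 1 - Poly_Mapping.single (a, b, c) 1
         - Poly_Mapping.single (a, b, c') 1 | a b c c'. True}
    \<union> {Poly_Mapping.single (scale s a, b, c) 1 - Poly_Mapping.single (a, b, c) s | s a b c. True}
    \<union> {Poly_Mapping.single (a, scale s b, c) 1 - Poly_Mapping.single (a, b, c) s | s a b c. True}
    \<union> {Poly_Mapping.single (a, b, scale s c) 1 - Poly_Mapping.single (a, b, c) s | s a b c. True})"

definition tensor2 :: "('k \<Rightarrow> 'a \<Rightarrow> 'a) \<Rightarrow> ('a::ring \<times> 'a \<Rightarrow>\<^sub>0 'k::field) set set" where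
  "tensor2 scale = {u +o rel2 scale | u. True}"

definition tens2 :: "('k \<Rightarrow> 'a \<Rightarrow> 'a) \<Rightarrow> 'a::ring \<Rightarrow> 'a \<Rightarrow> ('a \<times> 'a \<Rightarrow>\<^sub>0 'k::field) set" where
  "tens2 scale a b = Poly_Mapping.single (a, b) 1 +o rel2 scale"

definition tens3 ::
  "('k \<Rightarrow> 'a \<Rightarrow> 'a) \<Rightarrow> 'a::ring \<Rightarrow> 'a \<Rightarrow> 'a \<Rightarrow> ('a \<times> 'a \<times> 'a \<Rightarrow>\<^sub>0 'k::field) set" where
  "tens3 scale a b c = Poly_Mapping.single (a, b, c) 1 +o rel3 scale"

definition swap2 ::
  "('k \<Rightarrow> 'a \<Rightarrow> 'a) \<Rightarrow> ('a::ring \<times> 'a \<Rightarrow>\<^sub>0 'k::field) set \<Rightarrow> ('a \<times> 'a \<Rightarrow>\<^sub>0 'k) set" where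
  "swap2 scale = lin_extend (rel2 scale) (\<lambda>(x, y). tens2 scale y x)"

text \<open>\<open>\<sigma>\<close> is a permutation of \<open>nat\<close> that fixes every number outside \<open>{1, 2, 3}\<close>;
  the permutations below are given by \<open>cycle_of_list\<close>, which sends each entry to the next one.\<close>

definition tau3 ::
  "('k \<Rightarrow> 'a \<Rightarrow> 'a) \<Rightarrow> (nat \<Rightarrow> nat) \<Rightarrow>
    ('a::ring \<times> 'a \<times> 'a \<Rightarrow>\<^sub>0 'k::field) set \<Rightarrow> ('a \<times> 'a \<times> 'a \<Rightarrow>\<^sub>0 'k) set" where
  "tau3 scale \<sigma> = lin_extend (rel3 scale)
     (\<lambda>(a1, a2, a3).
        let a = (\<lambda>i::nat. if i = 1 then a1 else if i = 2 then a2 else a3);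
            \<rho> = inv_into UNIV \<sigma>
        in tens3 scale (a (\<rho> 1)) (a (\<rho> 2)) (a (\<rho> 3)))"

definition double_bracket ::
  "('k \<Rightarrow> 'a \<Rightarrow> 'a) \<Rightarrow> ('a::ring \<Rightarrow> 'a \<Rightarrow> ('a \<times> 'a \<Rightarrow>\<^sub>0 'k::field) set) \<Rightarrow> bool" where
  "double_bracket scale db \<longleftrightarrow>
     (\<forall>a b. db a b \<in> tensor2 scale) \<and>
     (\<forall>a a' b. db (a + a') b = db a b + db a' b) \<and>
     (\<forall>a b b'. db a (b + b') = db a b + db a b') \<and>
     (\<forall>c a b. db (scale c a) b = coset_scale (rel2 scale) c (db a b)) \<and>
     (\<forall>c a b. db a (scale c b) = coset_scale (rel2 scale) c (db a b)) \<and>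
     (\<forall>a b. db a b = uminus ` swap2 scale (db b a)) \<and>
     (\<forall>a b c. db a (b * c) =
        lin_extend (rel2 scale) (\<lambda>(x, y). tens2 scale x (b * y)) (db a c)
      + lin_extend (rel2 scale) (\<lambda>(x, y). tens2 scale x (y * c)) (db a b)) \<and>
     (\<forall>a b c. db (b * c) a =
        lin_extend (rel2 scale) (\<lambda>(x, y). tens2 scale (b * x) y) (db c a)
      + lin_extend (rel2 scale) (\<lambda>(x, y). tens2 scale (x * c) y) (db b a))"

definition bracket_L ::
  "('k \<Rightarrow> 'a \<Rightarrow> 'a) \<Rightarrow> ('a::ring \<Rightarrow> 'a \<Rightarrow> ('a \<times> 'a \<Rightarrow>\<^sub>0 'k::field) set) \<Rightarrow>
    'a \<Rightarrow> ('a \<times> 'a \<Rightarrow>\<^sub>0 'k) set \<Rightarrow> ('a \<times> 'a \<times> 'a \<Rightarrow>\<^sub>0 'k) set" where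
  "bracket_L scale db a = lin_extend (rel3 scale)
     (\<lambda>(b1, b2). lin_extend (rel3 scale) (\<lambda>(x, y). tens3 scale x y b2) (db a b1))"

definition double_jacobiator ::
  "('k \<Rightarrow> 'a \<Rightarrow> 'a) \<Rightarrow> ('a::ring \<Rightarrow> 'a \<Rightarrow> ('a \<times> 'a \<Rightarrow>\<^sub>0 'k::field) set) \<Rightarrow>
    'a \<Rightarrow> 'a \<Rightarrow> 'a \<Rightarrow> ('a \<times> 'a \<times> 'a \<Rightarrow>\<^sub>0 'k) set" where
  "double_jacobiator scale db a b c =
     bracket_L scale db a (db b c)
   + tau3 scale (cycle_of_list [1, 2, 3]) (bracket_L scale db b (db c a))
   + tau3 scale (cycle_of_list [1, 3, 2]) (bracket_L scale db c (db a b))"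

definition weak_double_jacobiator ::
  "('k \<Rightarrow> 'a \<Rightarrow> 'a) \<Rightarrow> ('a::ring \<Rightarrow> 'a \<Rightarrow> ('a \<times> 'a \<Rightarrow>\<^sub>0 'k::field) set) \<Rightarrow>
    'a \<Rightarrow> 'a \<Rightarrow> 'a \<Rightarrow> ('a \<times> 'a \<times> 'a \<Rightarrow>\<^sub>0 'k) set" where
  "weak_double_jacobiator scale db a b c =
     double_jacobiator scale db a b c
   + uminus ` tau3 scale (cycle_of_list [1, 2]) (double_jacobiator scale db b a c)"

definition weak_poisson ::
  "('k \<Rightarrow> 'a \<Rightarrow> 'a) \<Rightarrow> ('a::ring \<Rightarrow> 'a \<Rightarrow> ('a \<times> 'a \<Rightarrow>\<^sub>0 'k::field) set) \<Rightarrow> bool" where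
  "weak_poisson scale db \<longleftrightarrow>
     double_bracket scale db \<and> (\<forall>a b c. weak_double_jacobiator scale db a b c = rel3 scale)"

text \<open>The finite type \<open>'n\<close> indexes the rows and columns of the matrices, so the matrix size is
  \<open>CARD('n) \<ge> 1\<close>. A polynomial in the symbols \<open>a\<^sub>i\<^sub>j\<close> is a finitely supported function on
  monomials, with the convolution product of \<open>Poly_Mapping\<close>.\<close>

type_synonym ('a, 'n, 'k) rep_poly = "('a \<times> 'n \<times> 'n \<Rightarrow>\<^sub>0 nat) \<Rightarrow>\<^sub>0 'k"

definition poly_const :: "'k \<Rightarrow> ('a, 'n, 'k::field) rep_poly" where
  "poly_const c = Poly_Mapping.single 0 c"

definition poly_var :: "'a \<Rightarrow> 'n \<Rightarrow> 'n \<Rightarrow> ('a, 'n, 'k::field) rep_poly" where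
  "poly_var a i j = Poly_Mapping.single (Poly_Mapping.single (a, i, j) 1) 1"

definition rep_ideal ::
  "('k \<Rightarrow> 'a \<Rightarrow> 'a) \<Rightarrow> ('a::{ring, monoid_mult}, 'n::finite, 'k::field) rep_poly set" where
  "rep_ideal scale = Idl\<^bsub>ring_of_type_algebra\<^esub>
     ({poly_const l * poly_var a i j + poly_const m * poly_var b i j
         - poly_var (scale l a + scale m b) i j | l m a b i j. True}
    \<union> {poly_var 1 i j - (if i = j then 1 else 0) | i j. True}
    \<union> {poly_var (a * b) i j - (\<Sum>k\<in>UNIV. poly_var a i k * poly_var b k j) | a b i j. True})"

definition rep_alg ::
  "('k \<Rightarrow> 'a \<Rightarrow> 'a) \<Rightarrow> ('a::{ring, monoid_mult}, 'n::finite, 'k::field) rep_poly set ring" where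
  "rep_alg scale = ring_of_type_algebra Quot (rep_ideal scale)"

definition rep_const ::
  "('k \<Rightarrow> 'a \<Rightarrow> 'a) \<Rightarrow> 'k \<Rightarrow> ('a::{ring, monoid_mult}, 'n::finite, 'k::field) rep_poly set" where
  "rep_const scale c = rep_ideal scale +>\<^bsub>ring_of_type_algebra\<^esub> poly_const c"

definition rep_gen ::
  "('k \<Rightarrow> 'a \<Rightarrow> 'a) \<Rightarrow> 'a \<Rightarrow> 'n \<Rightarrow> 'n \<Rightarrow>
    ('a::{ring, monoid_mult}, 'n::finite, 'k::field) rep_poly set" where
  "rep_gen scale a i j = rep_ideal scale +>\<^bsub>ring_of_type_algebra\<^esub> poly_var a i j"

definition rep_trace ::
  "('k \<Rightarrow> 'a \<Rightarrow> 'a) \<Rightarrow> 'a \<Rightarrow> ('a::{ring, monoid_mult}, 'n::finite, 'k::field) rep_poly set" where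
  "rep_trace scale a = (\<Oplus>\<^bsub>rep_alg scale\<^esub>i\<in>UNIV. rep_gen scale a i i)"

definition trace_ring ::
  "('k \<Rightarrow> 'a \<Rightarrow> 'a) \<Rightarrow> ('a::{ring, monoid_mult}, 'n::finite, 'k::field) rep_poly set set" where
  "trace_ring scale =
     generate_ring (rep_alg scale) (range (rep_const scale) \<union> range (rep_trace scale))"

text \<open>\<open>\<eta>\<close> is the structure map of a commutative algebra \<open>R\<close> over a field.\<close>

definition derivation :: "('k \<Rightarrow> 'r) \<Rightarrow> 'r ring \<Rightarrow> ('r \<Rightarrow> 'r) \<Rightarrow> bool" where
  "derivation \<eta> R D \<longleftrightarrow>
     D \<in> carrier R \<rightarrow> carrier R \<and>
     (\<forall>f\<in>carrier R. \<forall>g\<in>carrier R. D (f \<oplus>\<^bsub>R\<^esub> g) = D f \<oplus>\<^bsub>R\<^esub> D g) \<and>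
     (\<forall>c. \<forall>f\<in>carrier R. D (\<eta> c \<otimes>\<^bsub>R\<^esub> f) = \<eta> c \<otimes>\<^bsub>R\<^esub> D f) \<and>
     (\<forall>f\<in>carrier R. \<forall>g\<in>carrier R. D (f \<otimes>\<^bsub>R\<^esub> g) = D f \<otimes>\<^bsub>R\<^esub> g \<oplus>\<^bsub>R\<^esub> f \<otimes>\<^bsub>R\<^esub> D g)"

text \<open>Membership in \<open>\<rightarrow>\<^sub>E\<close> makes a bracket determined by its values on the carrier.\<close>

definition antisym_biderivation :: "('k \<Rightarrow> 'r) \<Rightarrow> 'r ring \<Rightarrow> ('r \<Rightarrow> 'r \<Rightarrow> 'r) \<Rightarrow> bool" where
  "antisym_biderivation \<eta> R br \<longleftrightarrow>
     br \<in> carrier R \<rightarrow>\<^sub>E (carrier R \<rightarrow>\<^sub>E carrier R) \<and>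
     (\<forall>f\<in>carrier R. derivation \<eta> R (\<lambda>g. br f g)) \<and>
     (\<forall>g\<in>carrier R. derivation \<eta> R (\<lambda>f. br f g)) \<and>
     (\<forall>f\<in>carrier R. \<forall>g\<in>carrier R. br f g = \<ominus>\<^bsub>R\<^esub> br g f)"

definition poisson_bracket :: "('k \<Rightarrow> 'r) \<Rightarrow> 'r ring \<Rightarrow> ('r \<Rightarrow> 'r \<Rightarrow> 'r) \<Rightarrow> bool" where
  "poisson_bracket \<eta> R br \<longleftrightarrow>
     antisym_biderivation \<eta> R br \<and>
     (\<forall>f\<in>carrier R. \<forall>g\<in>carrier R. \<forall>h\<in>carrier R.
        br f (br g h) \<oplus>\<^bsub>R\<^esub> br g (br h f) \<oplus>\<^bsub>R\<^esub> br h (br f g) = \<zero>\<^bsub>R\<^esub>)"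

definition induced_biderivation ::
  "('k \<Rightarrow> 'a \<Rightarrow> 'a) \<Rightarrow> ('a::{ring, monoid_mult} \<Rightarrow> 'a \<Rightarrow> ('a \<times> 'a \<Rightarrow>\<^sub>0 'k::field) set) \<Rightarrow>
    (('a, 'n::finite, 'k) rep_poly set \<Rightarrow> ('a, 'n, 'k) rep_poly set \<Rightarrow> ('a, 'n, 'k) rep_poly set)
    \<Rightarrow> bool" where
  "induced_biderivation scale db br \<longleftrightarrow>
     antisym_biderivation (rep_const scale) (rep_alg scale) br \<and>
     (\<forall>a b i j k l. br (rep_gen scale a i j) (rep_gen scale b k l) =
        lin_extend (rep_ideal scale)
          (\<lambda>(x, y). rep_gen scale x i j \<otimes>\<^bsub>rep_alg scale\<^esub> rep_gen scale y k l) (db a b))"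

end

theory Submission
  imports Defs
begin

text \<open>A derivation of a polynomial ring may be prescribed freely on the variables. Doing this in each
  argument produces a biderivation of the polynomial ring in the symbols \<open>a\<^sub>i\<^sub>j\<close> with
  \<open>{a\<^sub>i\<^sub>j, b\<^sub>k\<^sub>l} = d'\<^sub>i\<^sub>j d''\<^sub>k\<^sub>l\<close>, where \<open>d\<close> is any representative of the double bracket of \<open>a\<close> and \<open>b\<close>.
  All other claims are congruences modulo the ideal of relations of the representation algebra.

  The bracket passes to the quotient because the linearity and the Leibniz rule of the double
  bracket in its second argument make the bracket of a variable with a relation an element of the
  ideal. The first argument follows from antisymmetry modulo the ideal, which is the
  antisymmetry of the double bracket. Uniqueness holds because a derivation of the quotient is
  determined by the images of the generators.

  Modulo the ideal, the Jacobiator is cyclically symmetric and a derivation in each argument, so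
  the Jacobi identity has to be checked on variables only. For index pairs \<open>p\<close>, \<open>q\<close>, \<open>r\<close>, let
  \<open>L(a, b, c)\<^sub>p\<^sub>q\<^sub>r\<close> be the value of the iterated bracket \<open>{a, {b, c}}\<^sub>L\<close> when its three tensor factors
  are replaced by their matrix entries at \<open>p\<close>, \<open>q\<close>, \<open>r\<close>. By the Leibniz rule \<open>{a\<^sub>p, {b\<^sub>q, c\<^sub>r}}\<close> is a sum of
  two terms. In one, \<open>a\<close> meets the first factor of the double bracket of \<open>b\<close> and \<open>c\<close>; this is
  \<open>L(a, b, c)\<^sub>p\<^sub>q\<^sub>r\<close>. In the other it meets the second factor; antisymmetry turns that factor into the
  first factor of the double bracket of \<open>c\<close> and \<open>b\<close>, which gives \<open>- L(a, c, b)\<^sub>p\<^sub>r\<^sub>q\<close>. In the sum over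
  the three cyclic permutations, the positive terms are the values of the double Jacobiator of
  \<open>(a, b, c)\<close>, and the negative ones those of the double Jacobiator of \<open>(b, a, c)\<close> with its first two
  factors exchanged. The total is the value of the weak double Jacobiator, which vanishes.

  Finally \<open>{tr a, tr b} = tr d' tr d''\<close> is a polynomial in traces, and the Leibniz rule extends this to the
  ring that the traces generate.\<close>

section \<open>Linear extension and quotients of free vector spaces\<close>

lemma lookup_free_scale [simp]: "Poly_Mapping.lookup (free_scale c u) x = c * Poly_Mapping.lookup u x"
  by (simp add: free_scale_def map.rep_eq when_def)

interpretation free: vector_space "free_scale :: 'k::field \<Rightarrow> ('x \<Rightarrow>\<^sub>0 'k) \<Rightarrow> ('x \<Rightarrow>\<^sub>0 'k)"
  by standard (auto intro!: poly_mapping_eqI simp: lookup_add algebra_simps)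

lemma free_scale_single [simp]: "free_scale c (Poly_Mapping.single x d) = Poly_Mapping.single x (c * d)"
  by (rule poly_mapping_eqI) (simp add: lookup_single when_def)

definition linear_ext :: "('x \<Rightarrow> ('y \<Rightarrow>\<^sub>0 'k::field)) \<Rightarrow> ('x \<Rightarrow>\<^sub>0 'k) \<Rightarrow> ('y \<Rightarrow>\<^sub>0 'k)" where
  "linear_ext h u = (\<Sum>x\<in>Poly_Mapping.keys u. free_scale (Poly_Mapping.lookup u x) (h x))"

lemma linear_ext_superset:
  assumes "finite S" "Poly_Mapping.keys u \<subseteq> S"
  shows "linear_ext h u = (\<Sum>x\<in>S. free_scale (Poly_Mapping.lookup u x) (h x))"
  unfolding linear_ext_def
  by (rule sum.mono_neutral_left) (use assms in \<open>auto simp: in_keys_iff\<close>)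

lemma linear_ext_zero [simp]: "linear_ext h 0 = 0"
  by (simp add: linear_ext_def)

lemma linear_ext_single [simp]: "linear_ext h (Poly_Mapping.single x c) = free_scale c (h x)"
  by (simp add: linear_ext_def)

lemma linear_ext_add [simp]: "linear_ext h (u + v) = linear_ext h u + linear_ext h v"
proof -
  let ?S = "Poly_Mapping.keys u \<union> Poly_Mapping.keys v"
  have "linear_ext h w = (\<Sum>x\<in>?S. free_scale (Poly_Mapping.lookup w x) (h x))"
    if "Poly_Mapping.keys w \<subseteq> ?S" for w
    by (rule linear_ext_superset) (use that in auto)
  with keys_add[of u v] show ?thesis
    by (simp add: lookup_add free.scale_left_distrib sum.distrib)
qed

lemma linear_ext_scale [simp]: "linear_ext h (free_scale c u) = free_scale c (linear_ext h u)"
proof -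
  have "linear_ext h (free_scale c u) =
    (\<Sum>x\<in>Poly_Mapping.keys u. free_scale (Poly_Mapping.lookup (free_scale c u) x) (h x))"
    by (rule linear_ext_superset) (auto simp: in_keys_iff)
  then show ?thesis
    by (simp add: linear_ext_def free.scale_sum_right)
qed

lemma linear_ext_uminus [simp]: "linear_ext h (- u) = - linear_ext h u"
  using linear_ext_scale[of h "-1" u] by simp

lemma linear_ext_diff [simp]: "linear_ext h (u - v) = linear_ext h u - linear_ext h v"
  using linear_ext_add[of h u "- v"] by simp

lemma linear_ext_sum: "linear_ext h (\<Sum>i\<in>S. u i) = (\<Sum>i\<in>S. linear_ext h (u i))"
  by (induction S rule: infinite_finite_induct) auto

lemma linear_ext_linear_ext: "linear_ext h (linear_ext g u) = linear_ext (\<lambda>x. linear_ext h (g x)) u"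
  by (simp add: linear_ext_def[of _ u] linear_ext_sum)

lemma linear_ext_ptw_add: "linear_ext (\<lambda>x. g x + h x) u = linear_ext g u + linear_ext h u"
  by (simp add: linear_ext_def free.scale_right_distrib sum.distrib)

lemma linear_ext_ptw_diff: "linear_ext (\<lambda>x. g x - h x) u = linear_ext g u - linear_ext h u"
  by (simp add: linear_ext_def free.scale_right_diff_distrib sum_subtractf)

lemma linear_ext_ptw_scale: "linear_ext (\<lambda>x. free_scale c (h x)) u = free_scale c (linear_ext h u)"
  by (simp add: linear_ext_def free.scale_sum_right mult.commute)

lemma linear_ext_ptw_sum: "linear_ext (\<lambda>x. \<Sum>i\<in>S. h i x) u = (\<Sum>i\<in>S. linear_ext (h i) u)"
  by (simp add: linear_ext_def free.scale_sum_right sum.swap[of _ S])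

lemma linear_ext_in_subspace:
  assumes "free.subspace N" "\<And>x. h x \<in> N"
  shows "linear_ext h u \<in> N"
  unfolding linear_ext_def by (intro free.subspace_sum free.subspace_scale assms)

lemma linear_ext_span_subset:
  assumes "free.subspace N" "\<And>r. r \<in> S \<Longrightarrow> linear_ext h r \<in> N" "u \<in> free.span S"
  shows "linear_ext h u \<in> N"
proof -
  have "free.subspace {u. linear_ext h u \<in> N}"
    using assms(1) by (auto simp: free.subspace_def)
  with assms(2,3) show ?thesis
    using free.span_minimal[of S "{u. linear_ext h u \<in> N}"] by auto
qed

lemma coset_eq_iff:
  fixes N :: "('x \<Rightarrow>\<^sub>0 'k::field) set"
  assumes "free.subspace N"
  shows "u +o N = v +o N \<longleftrightarrow> u - v \<in> N"
proof
  assume "u +o N = v +o N"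
  then show "u - v \<in> N"
    using set_plus_intro2[of 0 N u] free.subspace_0[OF assms] by (simp add: set_minus_plus)
next
  assume "u - v \<in> N"
  then have "v - u \<in> N" using free.subspace_neg[OF assms] by (metis minus_diff_eq)
  have *: "x +o N \<subseteq> y +o N" if "x - y \<in> N" for x y
  proof
    fix z assume "z \<in> x +o N"
    then have "z - x \<in> N" by (rule set_plus_imp_minus)
    from free.subspace_add[OF assms this that] show "z \<in> y +o N"
      by (simp add: set_minus_imp_plus)
  qed
  show "u +o N = v +o N"
    using *[OF \<open>u - v \<in> N\<close>] *[OF \<open>v - u \<in> N\<close>] by auto
qed

lemma coset_eq_subspace_iff:
  assumes "free.subspace N"
  shows "u +o N = N \<longleftrightarrow> u \<in> N"
  using coset_eq_iff[OF assms, of u 0] by simp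

lemma subspace_plus_self:
  assumes "free.subspace N"
  shows "N + N = N"
proof
  show "N + N \<subseteq> N"
    using free.subspace_add[OF assms] by (auto elim!: set_plus_elim)
  show "N \<subseteq> N + N"
    using set_zero_plus2[OF free.subspace_0[OF assms]] .
qed

lemma coset_add:
  assumes "free.subspace N"
  shows "(u +o N) + (v +o N) = (u + v) +o N"
  by (simp add: set_plus_rearrange subspace_plus_self assms)

lemma coset_uminus:
  assumes "free.subspace N"
  shows "uminus ` (u +o N) = (- u) +o N"
proof (intro equalityI subsetI)
  fix z assume "z \<in> uminus ` (u +o N)"
  then obtain n where "n \<in> N" "z = - (u + n)" by (auto simp: elt_set_plus_def)
  then show "z \<in> (- u) +o N"
    using free.subspace_neg[OF assms, of n] set_plus_intro2[of "- n" N "- u"] by simp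
next
  fix z assume "z \<in> (- u) +o N"
  then obtain n where "n \<in> N" "z = - u + n" by (auto simp: elt_set_plus_def)
  then have "z = - (u + - n)" "- n \<in> N" using free.subspace_neg[OF assms] by auto
  then show "z \<in> uminus ` (u +o N)" by blast
qed

lemma coset_scale_coset:
  assumes "free.subspace N"
  shows "coset_scale N c (u +o N) = free_scale c u +o N"
proof -
  have "free_scale c v +o N = free_scale c u +o N" if "v \<in> u +o N" for v
    using free.subspace_scale[OF assms set_plus_imp_minus[OF that], of c]
    by (simp add: coset_eq_iff[OF assms] free.scale_right_diff_distrib)
  moreover have "u \<in> u +o N"
    using set_plus_intro2[OF free.subspace_0[OF assms], of u] by simp
  ultimately show ?thesis
    unfolding coset_scale_def by blast
qed

lemma coset_sum:
  assumes "free.subspace N" "finite S"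
  shows "(\<Sum>x\<in>S. f x +o N) + N = (\<Sum>x\<in>S. f x) +o N"
  using assms(2)
proof induction
  case (insert x S)
  then have "(\<Sum>x\<in>insert x S. f x +o N) + N = (f x +o N) + ((\<Sum>x\<in>S. f x +o N) + N)"
    by (simp add: add.assoc)
  with insert show ?case
    by (simp add: coset_add[OF assms(1)])
qed (simp add: set_zero_plus)

text \<open>Turns the coset-valued extension into an extension between free vector spaces, so that every
  identity between elements of tensor powers or of the representation algebra becomes a membership
  in a subspace. The last hypothesis makes the result independent of the representative \<open>u\<close>.\<close>

lemma lin_extend_coset:
  assumes N: "free.subspace N" and M: "free.subspace M"
    and g: "\<And>x. g x = h x +o N" and MN: "\<And>r. r \<in> M \<Longrightarrow> linear_ext h r \<in> N"
  shows "lin_extend N g (u +o M) = linear_ext h u +o N"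
proof -
  have summand: "(\<Sum>x\<in>Poly_Mapping.keys v. coset_scale N (Poly_Mapping.lookup v x) (g x)) + N
      = linear_ext h v +o N" for v
    unfolding g coset_scale_coset[OF N] linear_ext_def by (rule coset_sum[OF N]) simp
  have "linear_ext h v +o N = linear_ext h u +o N" if "v \<in> u +o M" for v
    using MN[OF set_plus_imp_minus[OF that]] by (simp add: coset_eq_iff[OF N])
  moreover have "u \<in> u +o M"
    using set_plus_intro2[OF free.subspace_0[OF M], of u] by simp
  ultimately show ?thesis
    unfolding lin_extend_def summand by blast
qed

section \<open>Derivations of polynomial rings\<close>

definition pvar :: "'v \<Rightarrow> (('v \<Rightarrow>\<^sub>0 nat) \<Rightarrow>\<^sub>0 'k::field)" where
  "pvar v = Poly_Mapping.single (Poly_Mapping.single v 1) 1"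

lemma free_scale_eq_mult:
  fixes p :: "('v \<Rightarrow>\<^sub>0 nat) \<Rightarrow>\<^sub>0 'k::field"
  shows "free_scale c p = Poly_Mapping.single 0 c * p"
  by (simp add: free_scale_def mult_map_scale_conv_mult)

lemma free_scale_mult_left:
  fixes p :: "('v \<Rightarrow>\<^sub>0 nat) \<Rightarrow>\<^sub>0 'k::field"
  shows "free_scale c p * q = free_scale c (p * q)"
  by (simp add: free_scale_eq_mult mult_ac)

lemma free_scale_mult_right:
  fixes p :: "('v \<Rightarrow>\<^sub>0 nat) \<Rightarrow>\<^sub>0 'k::field"
  shows "p * free_scale c q = free_scale c (p * q)"
  by (simp add: free_scale_eq_mult mult_ac)

lemma linear_ext_mult_left:
  fixes f :: "('v \<Rightarrow>\<^sub>0 nat) \<Rightarrow>\<^sub>0 'k::field"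
  shows "f * linear_ext h u = linear_ext (\<lambda>x. f * h x) u"
  by (simp add: linear_ext_def sum_distrib_left free_scale_mult_right)

lemma linear_ext_basis: "linear_ext (\<lambda>x. Poly_Mapping.single x 1) u = u"
proof (rule poly_mapping_eqI)
  fix x
  have "Poly_Mapping.lookup (\<Sum>y\<in>S. Poly_Mapping.single y (Poly_Mapping.lookup u y)) x
      = (if x \<in> S then Poly_Mapping.lookup u x else 0)" if "finite S" for S
    using that by induction (auto simp: lookup_add lookup_single when_def)
  then show "Poly_Mapping.lookup (linear_ext (\<lambda>x. Poly_Mapping.single x 1) u) x = Poly_Mapping.lookup u x"
    by (simp add: linear_ext_def in_keys_iff)
qed

lemma free_induct [case_names single add scale]:
  fixes u :: "'x \<Rightarrow>\<^sub>0 'k::field"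
  assumes single: "\<And>x. P (Poly_Mapping.single x 1)"
    and add: "\<And>u v. P u \<Longrightarrow> P v \<Longrightarrow> P (u + v)"
    and scale: "\<And>c u. P u \<Longrightarrow> P (free_scale c u)"
  shows "P u"
proof -
  have zero: "P 0" using scale[OF single, of 0 undefined] by simp
  then have "free.subspace {u. P u}"
    using add scale by (auto simp: free.subspace_def)
  from linear_ext_in_subspace[OF this, of "\<lambda>x. Poly_Mapping.single x 1" u] single show ?thesis
    by (simp add: linear_ext_basis)
qed

text \<open>The inductive principle behind every reduction to generators: the variables generate the
  polynomial ring as an algebra.\<close>

lemma poly_induct [case_names var one add scale mult]:
  fixes f :: "('v \<Rightarrow>\<^sub>0 nat) \<Rightarrow>\<^sub>0 'k::field"
  assumes var: "\<And>v. P (pvar v)" and one: "P 1"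
    and add: "\<And>f g. P f \<Longrightarrow> P g \<Longrightarrow> P (f + g)"
    and scale: "\<And>c f. P f \<Longrightarrow> P (free_scale c f)"
    and mult: "\<And>f g. P f \<Longrightarrow> P g \<Longrightarrow> P (f * g)"
  shows "P f"
proof (induction f rule: free_induct)
  case (single m)
  have pow: "P (Poly_Mapping.single (Poly_Mapping.single v n) 1)" for v n
  proof (induction n)
    case (Suc n)
    have "Poly_Mapping.single (Poly_Mapping.single v (Suc n)) 1
        = pvar v * (Poly_Mapping.single (Poly_Mapping.single v n) 1 :: ('v \<Rightarrow>\<^sub>0 nat) \<Rightarrow>\<^sub>0 'k)"
      by (simp add: pvar_def mult_single flip: single_add)
    with Suc var[unfolded pvar_def] mult show ?case by (simp add: pvar_def)
  qed (use one in simp)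
  show ?case
  proof (induction m rule: update_induct)
    case const then show ?case using one by simp
  next
    case (update m v n)
    then have "Poly_Mapping.update v n m = m + Poly_Mapping.single v n"
      by (intro poly_mapping_eqI) (auto simp: lookup_update lookup_add lookup_single in_keys_iff when_def)
    then have "Poly_Mapping.single (Poly_Mapping.update v n m) 1
        = (Poly_Mapping.single m 1 * Poly_Mapping.single (Poly_Mapping.single v n) 1 :: ('v \<Rightarrow>\<^sub>0 nat) \<Rightarrow>\<^sub>0 'k)"
      by (simp add: mult_single)
    with update pow mult show ?case by simp
  qed
qed (use add scale in auto)

text \<open>The value at a monomial of the derivation \<open>\<Sum>\<^sub>v \<delta> v \<partial>/\<partial>v\<close>. Where \<open>v\<close> does not divide \<open>m\<close>, the truncated
  exponent \<open>m - v\<close> is harmless because its coefficient is zero.\<close>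

definition monomial_deriv ::
  "('v \<Rightarrow> (('v \<Rightarrow>\<^sub>0 nat) \<Rightarrow>\<^sub>0 'k)) \<Rightarrow> ('v \<Rightarrow>\<^sub>0 nat) \<Rightarrow> (('v \<Rightarrow>\<^sub>0 nat) \<Rightarrow>\<^sub>0 'k::field)" where
  "monomial_deriv \<delta> m = (\<Sum>v\<in>Poly_Mapping.keys m.
     Poly_Mapping.single (m - Poly_Mapping.single v 1) (of_nat (Poly_Mapping.lookup m v)) * \<delta> v)"

definition poly_deriv ::
  "('v \<Rightarrow> (('v \<Rightarrow>\<^sub>0 nat) \<Rightarrow>\<^sub>0 'k)) \<Rightarrow> (('v \<Rightarrow>\<^sub>0 nat) \<Rightarrow>\<^sub>0 'k) \<Rightarrow> (('v \<Rightarrow>\<^sub>0 nat) \<Rightarrow>\<^sub>0 'k::field)" where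
  "poly_deriv \<delta> = linear_ext (monomial_deriv \<delta>)"

lemma monomial_deriv_superset:
  assumes "finite S" "Poly_Mapping.keys m \<subseteq> S"
  shows "monomial_deriv \<delta> m = (\<Sum>v\<in>S. Poly_Mapping.single (m - Poly_Mapping.single v 1)
           (of_nat (Poly_Mapping.lookup m v)) * \<delta> v)"
  unfolding monomial_deriv_def
  by (rule sum.mono_neutral_left) (use assms in \<open>auto simp: in_keys_iff\<close>)

lemma monomial_deriv_add:
  fixes \<delta> :: "'v \<Rightarrow> (('v \<Rightarrow>\<^sub>0 nat) \<Rightarrow>\<^sub>0 'k::field)"
  shows "monomial_deriv \<delta> (m + n) =
    monomial_deriv \<delta> m * Poly_Mapping.single n 1 + Poly_Mapping.single m 1 * monomial_deriv \<delta> n"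
proof -
  let ?S = "Poly_Mapping.keys m \<union> Poly_Mapping.keys n"
  let ?t = "\<lambda>m v. Poly_Mapping.single (m - Poly_Mapping.single v 1)
      (of_nat (Poly_Mapping.lookup m v)) :: ('v \<Rightarrow>\<^sub>0 nat) \<Rightarrow>\<^sub>0 'k"
  \<comment> \<open>If \<open>v\<close> divides \<open>a\<close>, then lowering the exponent of \<open>v\<close> in \<open>a + b\<close> only affects \<open>a\<close>.\<close>
  have shift: "Poly_Mapping.single (a + b - Poly_Mapping.single v 1) (of_nat (Poly_Mapping.lookup a v))
      = ?t a v * Poly_Mapping.single b 1" for a b v
  proof (cases "Poly_Mapping.lookup a v = 0")
    case False
    then have "a + b - Poly_Mapping.single v 1 = (a - Poly_Mapping.single v 1) + b"
      by (intro poly_mapping_eqI) (auto simp: lookup_add lookup_minus lookup_single when_def)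
    then show ?thesis by (simp add: mult_single)
  qed simp
  have "?t (m + n) v = ?t m v * Poly_Mapping.single n 1 + Poly_Mapping.single m 1 * ?t n v" for v
    using shift[of m n v] shift[of n m v]
    by (simp add: lookup_add single_add add.commute mult.commute)
  moreover have "monomial_deriv \<delta> p = (\<Sum>v\<in>?S. ?t p v * \<delta> v)" if "Poly_Mapping.keys p \<subseteq> ?S" for p
    by (rule monomial_deriv_superset) (use that in auto)
  moreover have "Poly_Mapping.keys (m + n) \<subseteq> ?S" by (rule keys_add)
  ultimately show ?thesis
    by (simp add: algebra_simps sum.distrib sum_distrib_left)
qed

lemma poly_deriv_add [simp]: "poly_deriv \<delta> (f + g) = poly_deriv \<delta> f + poly_deriv \<delta> g"
  and poly_deriv_scale [simp]: "poly_deriv \<delta> (free_scale c f) = free_scale c (poly_deriv \<delta> f)"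
  and poly_deriv_zero [simp]: "poly_deriv \<delta> 0 = 0"
  and poly_deriv_uminus [simp]: "poly_deriv \<delta> (- f) = - poly_deriv \<delta> f"
  and poly_deriv_diff [simp]: "poly_deriv \<delta> (f - g) = poly_deriv \<delta> f - poly_deriv \<delta> g"
  by (simp_all add: poly_deriv_def)

lemma poly_deriv_var [simp]: "poly_deriv \<delta> (pvar v) = \<delta> v"
  by (simp add: poly_deriv_def monomial_deriv_def pvar_def)

lemma poly_deriv_one [simp]: "poly_deriv \<delta> 1 = 0"
  using linear_ext_single[of "monomial_deriv \<delta>" 0 1] by (simp add: poly_deriv_def monomial_deriv_def)

lemma poly_deriv_mult [simp]: "poly_deriv \<delta> (f * g) = poly_deriv \<delta> f * g + f * poly_deriv \<delta> g"
proof (induction f rule: free_induct)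
  case (single m)
  show ?case
  proof (induction g rule: free_induct)
    case (single n)
    show ?case by (simp add: poly_deriv_def mult_single monomial_deriv_add)
  qed (simp_all add: algebra_simps free_scale_mult_left free_scale_mult_right free.scale_right_distrib)
qed (simp_all add: algebra_simps free_scale_mult_left free_scale_mult_right free.scale_right_distrib)

lemma poly_deriv_ptw_add: "poly_deriv (\<lambda>v. \<delta> v + \<epsilon> v) f = poly_deriv \<delta> f + poly_deriv \<epsilon> f"
  by (induction f rule: poly_induct) (simp_all add: algebra_simps free.scale_right_distrib)

lemma poly_deriv_ptw_scale: "poly_deriv (\<lambda>v. free_scale c (\<delta> v)) f = free_scale c (poly_deriv \<delta> f)"
  by (induction f rule: poly_induct)
    (simp_all add: algebra_simps free.scale_right_distrib free_scale_mult_left free_scale_mult_right)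

lemma poly_deriv_ptw_mult: "poly_deriv (\<lambda>v. p * \<delta> v) f = p * poly_deriv \<delta> f"
  by (induction f rule: poly_induct)
    (simp_all add: algebra_simps free_scale_mult_left free_scale_mult_right)

section \<open>Biderivations and their Jacobiators modulo an ideal\<close>

text \<open>The biderivation with matrix \<open>\<beta>\<close>, that is \<open>{f, g} = \<Sum>\<^sub>v\<^sub>,\<^sub>w \<partial>f/\<partial>v \<partial>g/\<partial>w \<beta> v w\<close>. Nesting two derivations
  avoids partial derivatives and a double sum over the variables that occur.\<close>

definition poly_bracket :: "('v \<Rightarrow> 'v \<Rightarrow> (('v \<Rightarrow>\<^sub>0 nat) \<Rightarrow>\<^sub>0 'k)) \<Rightarrow> (('v \<Rightarrow>\<^sub>0 nat) \<Rightarrow>\<^sub>0 'k) \<Rightarrow>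
    (('v \<Rightarrow>\<^sub>0 nat) \<Rightarrow>\<^sub>0 'k) \<Rightarrow> (('v \<Rightarrow>\<^sub>0 nat) \<Rightarrow>\<^sub>0 'k::field)" where
  "poly_bracket \<beta> f g = poly_deriv (\<lambda>v. poly_deriv (\<beta> v) g) f"

lemma poly_bracket_left [simp]:
  "poly_bracket \<beta> (f + g) h = poly_bracket \<beta> f h + poly_bracket \<beta> g h"
  "poly_bracket \<beta> (free_scale c f) h = free_scale c (poly_bracket \<beta> f h)"
  "poly_bracket \<beta> (f * g) h = poly_bracket \<beta> f h * g + f * poly_bracket \<beta> g h"
  "poly_bracket \<beta> 1 h = 0" "poly_bracket \<beta> 0 h = 0" "poly_bracket \<beta> (- f) h = - poly_bracket \<beta> f h"
  "poly_bracket \<beta> (f - g) h = poly_bracket \<beta> f h - poly_bracket \<beta> g h"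
  by (simp_all add: poly_bracket_def)

lemma poly_bracket_var_var [simp]: "poly_bracket \<beta> (pvar v) (pvar w) = \<beta> v w"
  by (simp add: poly_bracket_def)

text \<open>For fixed \<open>h\<close> the bracket is a polynomial combination of the derivations given by the rows of \<open>\<beta>\<close>,
  hence a derivation in its second argument as well.\<close>

lemma poly_bracket_right [simp]:
  "poly_bracket \<beta> h (f + g) = poly_bracket \<beta> h f + poly_bracket \<beta> h g"
  "poly_bracket \<beta> h (free_scale c f) = free_scale c (poly_bracket \<beta> h f)"
  "poly_bracket \<beta> h (f * g) = poly_bracket \<beta> h f * g + f * poly_bracket \<beta> h g"
  "poly_bracket \<beta> h 1 = 0" "poly_bracket \<beta> h 0 = 0" "poly_bracket \<beta> h (- f) = - poly_bracket \<beta> h f"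
  "poly_bracket \<beta> h (f - g) = poly_bracket \<beta> h f - poly_bracket \<beta> h g"
proof -
  show add: "poly_bracket \<beta> h (f + g) = poly_bracket \<beta> h f + poly_bracket \<beta> h g" for f g
    by (simp add: poly_bracket_def poly_deriv_ptw_add)
  show sc: "poly_bracket \<beta> h (free_scale c f) = free_scale c (poly_bracket \<beta> h f)" for c f
    by (simp add: poly_bracket_def poly_deriv_ptw_scale)
  have "poly_bracket \<beta> h (f * g) = poly_deriv (\<lambda>v. g * poly_deriv (\<beta> v) f + f * poly_deriv (\<beta> v) g) h"
    by (simp add: poly_bracket_def mult.commute)
  then show "poly_bracket \<beta> h (f * g) = poly_bracket \<beta> h f * g + f * poly_bracket \<beta> h g"
    by (simp add: poly_deriv_ptw_add poly_deriv_ptw_mult poly_bracket_def mult.commute)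
  show "poly_bracket \<beta> h 1 = 0" using poly_deriv_ptw_scale[of 0 "\<lambda>_. 0" h] by (simp add: poly_bracket_def)
  show "poly_bracket \<beta> h 0 = 0" using sc[of 0 0] by simp
  show um: "poly_bracket \<beta> h (- f) = - poly_bracket \<beta> h f" for f using sc[of "-1" f] by simp
  show "poly_bracket \<beta> h (f - g) = poly_bracket \<beta> h f - poly_bracket \<beta> h g"
    using add[of f "- g"] um[of g] by simp
qed

lemma poly_bracket_sum_right: "poly_bracket \<beta> h (sum F S) = (\<Sum>i\<in>S. poly_bracket \<beta> h (F i))"
  by (induction S rule: infinite_finite_induct) auto

lemma poly_bracket_sum_left: "poly_bracket \<beta> (sum F S) h = (\<Sum>i\<in>S. poly_bracket \<beta> (F i) h)"
  by (induction S rule: infinite_finite_induct) auto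

lemma poly_bracket_linear_ext_right: "poly_bracket \<beta> h (linear_ext e u) = linear_ext (\<lambda>x. poly_bracket \<beta> h (e x)) u"
  by (simp add: linear_ext_def poly_bracket_sum_right)

abbreviation polyideal :: "(('v \<Rightarrow>\<^sub>0 nat) \<Rightarrow>\<^sub>0 'k::field) set \<Rightarrow> bool" where
  "polyideal I \<equiv> ideal I ring_of_type_algebra"

lemma polyideal_iff:
  fixes I :: "(('v \<Rightarrow>\<^sub>0 nat) \<Rightarrow>\<^sub>0 'k::field) set"
  shows "polyideal I \<longleftrightarrow> 0 \<in> I \<and> (\<forall>f\<in>I. \<forall>g\<in>I. f + g \<in> I) \<and> (\<forall>f\<in>I. \<forall>g. g * f \<in> I)"
    (is "_ \<longleftrightarrow> ?c")
proof
  interpret P: cring "ring_of_type_algebra :: (('v \<Rightarrow>\<^sub>0 nat) \<Rightarrow>\<^sub>0 'k) ring"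
    by (rule cring_from_type_algebra)
  assume "polyideal I"
  then interpret ideal I ring_of_type_algebra .
  show ?c
    using zero_closed a_closed I_l_closed by (simp add: ring_of_type_algebra_def)
next
  interpret P: cring "ring_of_type_algebra :: (('v \<Rightarrow>\<^sub>0 nat) \<Rightarrow>\<^sub>0 'k) ring"
    by (rule cring_from_type_algebra)
  assume c: ?c
  have "\<ominus>\<^bsub>ring_of_type_algebra\<^esub> f = - f" for f :: "('v \<Rightarrow>\<^sub>0 nat) \<Rightarrow>\<^sub>0 'k"
    by (rule P.minus_equality) (simp_all add: ring_of_type_algebra_def)
  moreover have "- f \<in> I" if "f \<in> I" for f
    using c that by (metis mult_minus1)
  ultimately show "polyideal I"
    using c
    by (intro idealI P.ring_axioms P.add.subgroupI)
      (auto simp: ring_of_type_algebra_def mult.commute a_inv_def)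
qed

lemma polyideal_closed:
  assumes "polyideal I"
  shows "0 \<in> I" "\<And>f g. f \<in> I \<Longrightarrow> g \<in> I \<Longrightarrow> f + g \<in> I" "\<And>f g. f \<in> I \<Longrightarrow> g * f \<in> I"
    "\<And>f g. f \<in> I \<Longrightarrow> f * g \<in> I" "\<And>f. f \<in> I \<Longrightarrow> - f \<in> I"
    "\<And>f g. f \<in> I \<Longrightarrow> g \<in> I \<Longrightarrow> f - g \<in> I"
    "\<And>f c. f \<in> I \<Longrightarrow> free_scale c f \<in> I"
    and polyideal_subspace: "free.subspace I"
proof -
  note c = assms[unfolded polyideal_iff]
  show m: "\<And>f g. f \<in> I \<Longrightarrow> g * f \<in> I" using c by blast
  show a: "\<And>f g. f \<in> I \<Longrightarrow> g \<in> I \<Longrightarrow> f + g \<in> I" using c by blast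
  show z: "0 \<in> I" using c by blast
  show "\<And>f g. f \<in> I \<Longrightarrow> f * g \<in> I" using m by (simp add: mult.commute)
  show n: "\<And>f. f \<in> I \<Longrightarrow> - f \<in> I" using m by (metis mult_minus1)
  show "\<And>f g. f \<in> I \<Longrightarrow> g \<in> I \<Longrightarrow> f - g \<in> I" using a n by (metis add_uminus_conv_diff)
  show s: "\<And>f c. f \<in> I \<Longrightarrow> free_scale c f \<in> I" using m by (simp add: free_scale_eq_mult)
  show "free.subspace I" using z a s by (auto simp: free.subspace_def)
qed

lemma polyideal_genideal: "polyideal (Idl\<^bsub>ring_of_type_algebra\<^esub> S)"
  and polyideal_gen_subset: "S \<subseteq> Idl\<^bsub>ring_of_type_algebra\<^esub> S"
  and polyideal_gen_minimal: "polyideal I \<Longrightarrow> S \<subseteq> I \<Longrightarrow> Idl\<^bsub>ring_of_type_algebra\<^esub> S \<subseteq> I"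
  for S :: "(('v \<Rightarrow>\<^sub>0 nat) \<Rightarrow>\<^sub>0 'k::field) set"
proof -
  interpret P: cring "ring_of_type_algebra :: (('v \<Rightarrow>\<^sub>0 nat) \<Rightarrow>\<^sub>0 'k) ring"
    by (rule cring_from_type_algebra)
  have S: "S \<subseteq> carrier ring_of_type_algebra" by (simp add: ring_of_type_algebra_def)
  show "polyideal (Idl\<^bsub>ring_of_type_algebra\<^esub> S)" by (rule P.genideal_ideal[OF S])
  show "S \<subseteq> Idl\<^bsub>ring_of_type_algebra\<^esub> S" by (rule P.genideal_self[OF S])
  show "polyideal I \<Longrightarrow> S \<subseteq> I \<Longrightarrow> Idl\<^bsub>ring_of_type_algebra\<^esub> S \<subseteq> I"
    by (rule P.genideal_minimal)
qed

text \<open>Representatives of an antisymmetric family of cosets are antisymmetric only modulo the ideal. The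
  symmetrised bracket is a biderivation, so its values on variables decide.\<close>

lemma poly_bracket_antisym:
  assumes I: "polyideal I" and \<beta>: "\<And>v w. \<beta> v w + \<beta> w v \<in> I"
  shows "poly_bracket \<beta> f g + poly_bracket \<beta> g f \<in> I"
proof (induction f rule: poly_induct)
  case (var v)
  show ?case
  proof (induction g rule: poly_induct)
    case (add f g)
    from polyideal_closed(2)[OF I this] show ?case by (simp add: algebra_simps)
  next
    case (scale c f)
    from polyideal_closed(7)[OF I this, of c] show ?case by (simp add: free.scale_right_distrib)
  next
    case (mult f g)
    from polyideal_closed(2)[OF I polyideal_closed(3)[OF I mult(1), of g] polyideal_closed(3)[OF I mult(2), of f]]
    show ?case by (simp add: algebra_simps)
  qed (use \<beta> polyideal_closed(1)[OF I] in auto)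
next
  case (add f g)
  from polyideal_closed(2)[OF I this] show ?case by (simp add: algebra_simps)
next
  case (scale c f)
  from polyideal_closed(7)[OF I this, of c] show ?case by (simp add: free.scale_right_distrib)
next
  case (mult f g)
  from polyideal_closed(2)[OF I polyideal_closed(3)[OF I mult(1), of g] polyideal_closed(3)[OF I mult(2), of f]]
  show ?case by (simp add: algebra_simps)
qed (use polyideal_closed(1)[OF I] in auto)

text \<open>The second argument may be tested on generators of the ideal by the Leibniz rule; the first one
  follows by antisymmetry.\<close>

lemma poly_bracket_descends:
  assumes \<beta>: "\<And>v w. \<beta> v w + \<beta> w v \<in> Idl\<^bsub>ring_of_type_algebra\<^esub> S"
    and S: "\<And>r v. r \<in> S \<Longrightarrow> poly_bracket \<beta> (pvar v) r \<in> Idl\<^bsub>ring_of_type_algebra\<^esub> S"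
    and f: "f \<in> Idl\<^bsub>ring_of_type_algebra\<^esub> S"
  shows "poly_bracket \<beta> g f \<in> Idl\<^bsub>ring_of_type_algebra\<^esub> S" "poly_bracket \<beta> f g \<in> Idl\<^bsub>ring_of_type_algebra\<^esub> S"
proof -
  let ?I = "Idl\<^bsub>ring_of_type_algebra\<^esub> S"
  note I = polyideal_genideal[of S]
  have gen: "poly_bracket \<beta> g r \<in> ?I" if "r \<in> S" for r
    by (induction g rule: poly_induct) (use S that polyideal_closed[OF I] in auto)
  have "polyideal {f\<in>?I. poly_bracket \<beta> g f \<in> ?I}"
    using polyideal_closed[OF I] by (auto simp: polyideal_iff)
  from polyideal_gen_minimal[OF this] gen polyideal_gen_subset[of S] f
  show 1: "poly_bracket \<beta> g f \<in> ?I" by blast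
  have "poly_bracket \<beta> f g + poly_bracket \<beta> g f \<in> ?I" by (rule poly_bracket_antisym[OF I \<beta>])
  from polyideal_closed(6)[OF I this 1] show "poly_bracket \<beta> f g \<in> ?I"
    by simp
qed

definition jacobiator :: "('v \<Rightarrow> 'v \<Rightarrow> (('v \<Rightarrow>\<^sub>0 nat) \<Rightarrow>\<^sub>0 'k)) \<Rightarrow> (('v \<Rightarrow>\<^sub>0 nat) \<Rightarrow>\<^sub>0 'k) \<Rightarrow>
    (('v \<Rightarrow>\<^sub>0 nat) \<Rightarrow>\<^sub>0 'k) \<Rightarrow> (('v \<Rightarrow>\<^sub>0 nat) \<Rightarrow>\<^sub>0 'k) \<Rightarrow> (('v \<Rightarrow>\<^sub>0 nat) \<Rightarrow>\<^sub>0 'k::field)" where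
  "jacobiator \<beta> f g h = poly_bracket \<beta> f (poly_bracket \<beta> g h)
     + poly_bracket \<beta> g (poly_bracket \<beta> h f) + poly_bracket \<beta> h (poly_bracket \<beta> f g)"

text \<open>The Jacobiator is a derivation in its first argument up to the terms
  \<open>{h, f\<^sub>2} ({g, f\<^sub>1} + {f\<^sub>1, g})\<close> and \<open>{h, f\<^sub>1} ({g, f\<^sub>2} + {f\<^sub>2, g})\<close>, which antisymmetry puts in the ideal.\<close>

lemma jacobiator_first_arg:
  assumes I: "polyideal I" and \<beta>: "\<And>v w. \<beta> v w + \<beta> w v \<in> I"
    and var: "\<And>v. jacobiator \<beta> (pvar v) g h \<in> I"
  shows "jacobiator \<beta> f g h \<in> I"
proof (induction f rule: poly_induct)
  case (add f1 f2)
  from polyideal_closed(2)[OF I this] show ?case by (simp add: jacobiator_def algebra_simps)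
next
  case (scale c f)
  from polyideal_closed(7)[OF I this, of c] show ?case by (simp add: jacobiator_def free.scale_right_distrib)
next
  case (mult f1 f2)
  let ?s = "\<lambda>f g. poly_bracket \<beta> f g + poly_bracket \<beta> g f"
  have "jacobiator \<beta> (f1 * f2) g h = jacobiator \<beta> f1 g h * f2 + f1 * jacobiator \<beta> f2 g h
      + poly_bracket \<beta> h f2 * ?s g f1 + poly_bracket \<beta> h f1 * ?s g f2"
    by (simp add: jacobiator_def algebra_simps)
  also have "\<dots> \<in> I"
    by (intro polyideal_closed(2)[OF I] polyideal_closed(3)[OF I poly_bracket_antisym[OF I \<beta>]]
        polyideal_closed(3)[OF I mult(2)] polyideal_closed(4)[OF I mult(1)])
  finally show ?case .
qed (use var polyideal_closed(1)[OF I] in \<open>auto simp: jacobiator_def\<close>)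

text \<open>Each argument can be rotated into the first position, where products and sums are split.\<close>

lemma jacobiator_in_ideal:
  assumes I: "polyideal I" and \<beta>: "\<And>v w. \<beta> v w + \<beta> w v \<in> I"
    and var: "\<And>u v w. jacobiator \<beta> (pvar u) (pvar v) (pvar w) \<in> I"
  shows "jacobiator \<beta> f g h \<in> I"
proof -
  have rot: "jacobiator \<beta> f g h = jacobiator \<beta> g h f" for f g h by (simp add: jacobiator_def algebra_simps)
  note step = jacobiator_first_arg[OF I \<beta>]
  have two: "jacobiator \<beta> g (pvar u) (pvar v) \<in> I" for u v g by (rule step, rule var)
  have one: "jacobiator \<beta> g (pvar u) h \<in> I" for u g h
    by (rule step, subst rot[symmetric], rule two)
  show ?thesis
    by (rule step, subst rot[symmetric], rule one)
qed

section \<open>Derivations and Poisson brackets on subrings\<close>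

lemma derivationD:
  assumes "derivation \<eta> R D" "f \<in> carrier R"
  shows "D f \<in> carrier R" and "g \<in> carrier R \<Longrightarrow> D (f \<oplus>\<^bsub>R\<^esub> g) = D f \<oplus>\<^bsub>R\<^esub> D g"
    and "D (\<eta> c \<otimes>\<^bsub>R\<^esub> f) = \<eta> c \<otimes>\<^bsub>R\<^esub> D f"
    and "g \<in> carrier R \<Longrightarrow> D (f \<otimes>\<^bsub>R\<^esub> g) = D f \<otimes>\<^bsub>R\<^esub> g \<oplus>\<^bsub>R\<^esub> f \<otimes>\<^bsub>R\<^esub> D g"
  using assms by (auto simp: derivation_def)

context
  fixes R :: "'r ring" (structure)
  assumes cring_R: "cring R"
begin

interpretation cring R by (rule cring_R)

lemma derivation_props:
  assumes D: "derivation \<eta> R D" and \<eta>: "\<And>c. \<eta> c \<in> carrier R"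
  shows derivation_one: "D \<one> = \<zero>" and derivation_const: "D (\<eta> c) = \<zero>"
    and derivation_zero: "D \<zero> = \<zero>"
    and derivation_a_inv: "f \<in> carrier R \<Longrightarrow> D (\<ominus> f) = \<ominus> D f"
proof -
  have cl: "D f \<in> carrier R" if "f \<in> carrier R" for f
    using D that by (auto simp: derivation_def)
  have "D (\<one> \<otimes> \<one>) = D \<one> \<otimes> \<one> \<oplus> \<one> \<otimes> D \<one>"
    using D unfolding derivation_def by blast
  then show one: "D \<one> = \<zero>"
    using cl[of \<one>] by (metis add.r_cancel_one' l_one one_closed r_one)
  have "D (\<eta> c \<otimes> \<one>) = \<eta> c \<otimes> D \<one>"
    using D unfolding derivation_def by blast
  then show "D (\<eta> c) = \<zero>" using one \<eta> by simp
  have "D (\<zero> \<oplus> \<zero>) = D \<zero> \<oplus> D \<zero>"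
    using D unfolding derivation_def by blast
  then show zero: "D \<zero> = \<zero>"
    using cl[of \<zero>] by (metis add.r_cancel_one' zero_closed l_zero)
  assume f: "f \<in> carrier R"
  then have "D (f \<oplus> \<ominus> f) = D f \<oplus> D (\<ominus> f)"
    using D unfolding derivation_def by blast
  then show "D (\<ominus> f) = \<ominus> D f"
    using f cl zero by (metis a_inv_closed minus_equality r_neg a_comm)
qed

text \<open>A derivation kills constants, so by the Leibniz rule it preserves a generated subalgebra as soon
  as it maps the generators into it.\<close>

lemma generate_ring_derivation_closed:
  assumes D: "derivation \<eta> R D" and \<eta>: "\<And>c. \<eta> c \<in> carrier R" and G: "G \<subseteq> carrier R"
    and gen: "\<And>g. g \<in> G \<Longrightarrow> D g \<in> generate_ring R (range \<eta> \<union> G)"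
    and x: "x \<in> generate_ring R (range \<eta> \<union> G)"
  shows "D x \<in> generate_ring R (range \<eta> \<union> G)"
proof -
  have sub: "subring (generate_ring R (range \<eta> \<union> G)) R"
    by (rule generate_ring_is_subring) (use \<eta> G in auto)
  note cl = subringE[OF sub]
  show ?thesis using x
  proof induction
    case one
    show ?case using derivation_one[OF D \<eta>] cl by simp
  next
    case (incl h)
    then show ?case using gen derivation_const[OF D \<eta>] cl by auto
  next
    case (a_inv h)
    then show ?case using derivation_a_inv[OF D \<eta>] cl by auto
  next
    case (eng_add h1 h2)
    then have "D (h1 \<oplus> h2) = D h1 \<oplus> D h2"
      using D cl(1) unfolding derivation_def by blast
    with eng_add cl show ?case by simp
  next
    case (eng_mult h1 h2)
    then have "D (h1 \<otimes> h2) = D h1 \<otimes> h2 \<oplus> h1 \<otimes> D h2"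
      using D cl(1) unfolding derivation_def by blast
    with eng_mult cl show ?case by simp
  qed
qed

lemma generate_ring_biderivation_closed:
  assumes br: "antisym_biderivation \<eta> R br" and \<eta>: "\<And>c. \<eta> c \<in> carrier R" and G: "G \<subseteq> carrier R"
    and gen: "\<And>g h. g \<in> G \<Longrightarrow> h \<in> G \<Longrightarrow> br g h \<in> generate_ring R (range \<eta> \<union> G)"
    and "x \<in> generate_ring R (range \<eta> \<union> G)" "y \<in> generate_ring R (range \<eta> \<union> G)"
  shows "br x y \<in> generate_ring R (range \<eta> \<union> G)"
proof -
  have "x \<in> carrier R" "y \<in> carrier R"
    using generate_ring_incl[of "range \<eta> \<union> G"] \<eta> G assms(5,6) by auto
  then have L: "g \<in> carrier R \<Longrightarrow> derivation \<eta> R (\<lambda>f. br f g)"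
    and R: "derivation \<eta> R (\<lambda>g. br x g)" for g
    using br by (auto simp: antisym_biderivation_def)
  have "br x g \<in> generate_ring R (range \<eta> \<union> G)" if "g \<in> G" for g
    by (rule generate_ring_derivation_closed[OF L \<eta> G]) (use that gen G assms(5) in auto)
  from generate_ring_derivation_closed[OF R \<eta> G this assms(6)] show ?thesis .
qed

text \<open>All the laws are inherited; only the additive inverse has to be compared, because in the
  restricted ring it is defined by a choice from the smaller carrier.\<close>

lemma poisson_bracket_subring:
  assumes P: "poisson_bracket \<eta> R br" and T: "subring T R" and \<eta>: "\<And>c. \<eta> c \<in> T"
    and closed: "\<And>f g. f \<in> T \<Longrightarrow> g \<in> T \<Longrightarrow> br f g \<in> T"
  shows "poisson_bracket \<eta> (R\<lparr>carrier := T\<rparr>) (\<lambda>f\<in>T. \<lambda>g\<in>T. br f g)"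
proof -
  note cl = subringE[OF T]
  have carrier_T: "carrier (R\<lparr>carrier := T\<rparr>) = T" by simp
  have carr: "f \<in> carrier R" if "f \<in> T" for f using that cl(1) by blast
  interpret T: ring "R\<lparr>carrier := T\<rparr>" by (rule subring_is_ring[OF T])
  have inv: "\<ominus>\<^bsub>R\<lparr>carrier := T\<rparr>\<^esub> f = \<ominus> f" if "f \<in> T" for f
    by (rule T.minus_equality) (use that cl carr in \<open>auto simp: l_neg\<close>)
  have anti: "br f g = \<ominus> br g f"
    and jac: "br f (br g h) \<oplus> br g (br h f) \<oplus> br h (br f g) = \<zero>"
    if "f \<in> T" "g \<in> T" "h \<in> T" for f g h
    using P that carr unfolding poisson_bracket_def antisym_biderivation_def by blast+
  have restrict: "derivation \<eta> (R\<lparr>carrier := T\<rparr>) E"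
    if D: "derivation \<eta> R D" and E: "\<And>g. g \<in> T \<Longrightarrow> E g = D g \<and> D g \<in> T" for D E
    using E cl \<eta> carr derivationD(2,3,4)[OF D carr] by (simp add: derivation_def)
  have deriv: "derivation \<eta> (R\<lparr>carrier := T\<rparr>) (\<lambda>g. (\<lambda>f\<in>T. \<lambda>g\<in>T. br f g) f g)"
       "derivation \<eta> (R\<lparr>carrier := T\<rparr>) (\<lambda>g. (\<lambda>f\<in>T. \<lambda>g\<in>T. br f g) g f)" if "f \<in> T" for f
  proof -
    have D: "derivation \<eta> R (\<lambda>g. br f g)" "derivation \<eta> R (\<lambda>g. br g f)"
      using P that carr unfolding poisson_bracket_def antisym_biderivation_def by blast+
    show "derivation \<eta> (R\<lparr>carrier := T\<rparr>) (\<lambda>g. (\<lambda>f\<in>T. \<lambda>g\<in>T. br f g) f g)"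
      by (rule restrict[OF D(1)]) (use that closed in auto)
    show "derivation \<eta> (R\<lparr>carrier := T\<rparr>) (\<lambda>g. (\<lambda>f\<in>T. \<lambda>g\<in>T. br f g) g f)"
      by (rule restrict[OF D(2)]) (use that closed in auto)
  qed
  have fn: "(\<lambda>f\<in>T. \<lambda>g\<in>T. br f g) \<in> T \<rightarrow>\<^sub>E (T \<rightarrow>\<^sub>E T)"
    using closed by auto
  have anti': "(\<lambda>f\<in>T. \<lambda>g\<in>T. br f g) f g = \<ominus>\<^bsub>R\<lparr>carrier := T\<rparr>\<^esub> (\<lambda>f\<in>T. \<lambda>g\<in>T. br f g) g f"
    if "f \<in> T" "g \<in> T" for f g
    using anti[OF that that(1)] that inv closed by simp
  have "antisym_biderivation \<eta> (R\<lparr>carrier := T\<rparr>) (\<lambda>f\<in>T. \<lambda>g\<in>T. br f g)"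
    unfolding antisym_biderivation_def carrier_T
    by (intro conjI ballI fn deriv anti')
  with jac closed show ?thesis
    by (simp add: poisson_bracket_def)
qed

end

section \<open>Poisson brackets on quotients of polynomial rings\<close>

lemma a_r_coset_type_algebra: "I +>\<^bsub>ring_of_type_algebra\<^esub> f = f +o I"
  by (auto simp: a_r_coset_def r_coset_def ring_of_type_algebra_def elt_set_plus_def add.commute)

abbreviation quot_const where "quot_const I c \<equiv> Poly_Mapping.single 0 c +o I"

context
  fixes I :: "(('v \<Rightarrow>\<^sub>0 nat) \<Rightarrow>\<^sub>0 'k::field) set"
  assumes I: "polyideal I"
begin

interpretation P: cring "ring_of_type_algebra :: (('v \<Rightarrow>\<^sub>0 nat) \<Rightarrow>\<^sub>0 'k) ring"
  by (rule cring_from_type_algebra)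
interpretation I: ideal I ring_of_type_algebra by (rule I)

lemma poly_quot_cring: "cring (ring_of_type_algebra Quot I)"
  by (rule I.quotient_is_cring) (rule P.is_cring)

interpretation Q: cring "ring_of_type_algebra Quot I" by (rule poly_quot_cring)

lemma poly_quot_carrier: "carrier (ring_of_type_algebra Quot I) = range (\<lambda>f. f +o I)"
  by (auto simp: FactRing_def A_RCOSETS_def' a_r_coset_type_algebra)
    (auto simp: ring_of_type_algebra_def)

lemma poly_quot_mem [simp]: "f +o I \<in> carrier (ring_of_type_algebra Quot I)"
  by (simp add: poly_quot_carrier)

lemma poly_quot_add [simp]: "(f +o I) \<oplus>\<^bsub>ring_of_type_algebra Quot I\<^esub> (g +o I) = (f + g) +o I"
  using I.a_rcos_sum[of f g]
  by (simp add: FactRing_def a_r_coset_type_algebra) (simp add: ring_of_type_algebra_def)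

lemma poly_quot_mult [simp]: "(f +o I) \<otimes>\<^bsub>ring_of_type_algebra Quot I\<^esub> (g +o I) = (f * g) +o I"
  using I.rcoset_mult_add[of f g]
  by (simp add: FactRing_def a_r_coset_type_algebra) (simp add: ring_of_type_algebra_def)

lemma poly_quot_zero: "\<zero>\<^bsub>ring_of_type_algebra Quot I\<^esub> = I"
  by (simp add: FactRing_def)

lemma poly_quot_one: "\<one>\<^bsub>ring_of_type_algebra Quot I\<^esub> = 1 +o I"
  by (simp add: FactRing_def a_r_coset_type_algebra) (simp add: ring_of_type_algebra_def)

lemma poly_quot_uminus [simp]: "\<ominus>\<^bsub>ring_of_type_algebra Quot I\<^esub> (f +o I) = (- f) +o I"
  by (rule Q.minus_equality) (simp_all add: poly_quot_zero)

lemma poly_quot_scale: "quot_const I c \<otimes>\<^bsub>ring_of_type_algebra Quot I\<^esub> (f +o I) = free_scale c f +o I"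
  by (simp add: free_scale_eq_mult)

lemma poly_quot_finsum:
  "finite S \<Longrightarrow> (\<Oplus>\<^bsub>ring_of_type_algebra Quot I\<^esub>i\<in>S. F i +o I) = (\<Sum>i\<in>S. F i) +o I"
  by (induction S rule: finite_induct) (auto simp: poly_quot_zero)

lemma poly_quot_derivation_eqI:
  assumes D: "derivation (quot_const I) (ring_of_type_algebra Quot I) D"
    and E: "derivation (quot_const I) (ring_of_type_algebra Quot I) E"
    and var: "\<And>v. D (pvar v +o I) = E (pvar v +o I)"
  shows "D (f +o I) = E (f +o I)"
proof (induction f rule: poly_induct)
  case one
  show ?case using derivation_one[OF poly_quot_cring D] derivation_one[OF poly_quot_cring E]
    by (simp add: poly_quot_one)
next
  case (add f g)
  have "D' ((f + g) +o I) = D' (f +o I) \<oplus>\<^bsub>ring_of_type_algebra Quot I\<^esub> D' (g +o I)"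
    if "derivation (quot_const I) (ring_of_type_algebra Quot I) D'" for D'
    using derivationD(2)[OF that poly_quot_mem poly_quot_mem, of f g] by (simp only: poly_quot_add)
  from this[OF D] this[OF E] show ?case by (simp only: add)
next
  case (scale c f)
  have "D' (free_scale c f +o I) = quot_const I c \<otimes>\<^bsub>ring_of_type_algebra Quot I\<^esub> D' (f +o I)"
    if "derivation (quot_const I) (ring_of_type_algebra Quot I) D'" for D'
    using derivationD(3)[OF that poly_quot_mem, of c f] by (simp only: poly_quot_scale)
  from this[OF D] this[OF E] show ?case by (simp only: scale)
next
  case (mult f g)
  have "D' ((f * g) +o I) = D' (f +o I) \<otimes>\<^bsub>ring_of_type_algebra Quot I\<^esub> (g +o I)
     \<oplus>\<^bsub>ring_of_type_algebra Quot I\<^esub> (f +o I) \<otimes>\<^bsub>ring_of_type_algebra Quot I\<^esub> D' (g +o I)"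
    if "derivation (quot_const I) (ring_of_type_algebra Quot I) D'" for D'
    using derivationD(4)[OF that poly_quot_mem poly_quot_mem, of f g] by (simp only: poly_quot_mult)
  from this[OF D] this[OF E] show ?case by (simp only: mult)
qed (rule var)

lemma poly_quot_biderivation_unique:
  assumes br: "antisym_biderivation (quot_const I) (ring_of_type_algebra Quot I) br"
    and br': "antisym_biderivation (quot_const I) (ring_of_type_algebra Quot I) br'"
    and var: "\<And>v w. br (pvar v +o I) (pvar w +o I) = br' (pvar v +o I) (pvar w +o I)"
  shows "br = br'"
proof -
  let ?R = "ring_of_type_algebra Quot I"
  have L: "derivation (quot_const I) ?R (\<lambda>f. br f (g +o I))"
          "derivation (quot_const I) ?R (\<lambda>f. br' f (g +o I))"
    and R: "derivation (quot_const I) ?R (\<lambda>f. br (g +o I) f)"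
          "derivation (quot_const I) ?R (\<lambda>f. br' (g +o I) f)" for g
    using br br' by (auto simp: antisym_biderivation_def)
  have "br (pvar v +o I) (g +o I) = br' (pvar v +o I) (g +o I)" for v g
    by (rule poly_quot_derivation_eqI[OF R var])
  then have eq: "br (f +o I) (g +o I) = br' (f +o I) (g +o I)" for f g
    by (rule poly_quot_derivation_eqI[OF L])
  have ext: "br \<in> carrier ?R \<rightarrow>\<^sub>E (carrier ?R \<rightarrow>\<^sub>E carrier ?R)"
            "br' \<in> carrier ?R \<rightarrow>\<^sub>E (carrier ?R \<rightarrow>\<^sub>E carrier ?R)"
    using br br' by (auto simp: antisym_biderivation_def)
  have "br C = br' C" if C: "C \<in> carrier ?R" for C
  proof (rule PiE_ext)
    show "br C \<in> carrier ?R \<rightarrow>\<^sub>E carrier ?R" "br' C \<in> carrier ?R \<rightarrow>\<^sub>E carrier ?R"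
      using ext C by auto
    fix D assume "D \<in> carrier ?R"
    with C eq show "br C D = br' C D" by (auto simp: poly_quot_carrier)
  qed
  then show ?thesis by (rule PiE_ext[OF ext])
qed

text \<open>The bracket of two cosets, through chosen representatives; the restrictions give it the
  extensional form that makes a bracket unique.\<close>

definition quot_bracket where
  "quot_bracket \<beta> = (\<lambda>C\<in>carrier (ring_of_type_algebra Quot I). \<lambda>D\<in>carrier (ring_of_type_algebra Quot I).
     poly_bracket \<beta> (SOME f. C = f +o I) (SOME g. D = g +o I) +o I)"

lemma quot_bracket_coset:
  assumes descends: "\<And>f g. f \<in> I \<Longrightarrow> poly_bracket \<beta> f g \<in> I \<and> poly_bracket \<beta> g f \<in> I"
  shows "quot_bracket \<beta> (f +o I) (g +o I) = poly_bracket \<beta> f g +o I"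
proof -
  define f' g' where "f' = (SOME f'. f +o I = f' +o I)" and "g' = (SOME g'. g +o I = g' +o I)"
  have "f +o I = f' +o I" "g +o I = g' +o I"
    unfolding f'_def g'_def by (rule someI, rule refl)+
  then have "f - f' \<in> I" "g - g' \<in> I"
    by (simp_all add: coset_eq_iff[OF polyideal_subspace[OF I]])
  then have "poly_bracket \<beta> (f - f') g + poly_bracket \<beta> f' (g - g') \<in> I"
    by (intro polyideal_closed(2)[OF I] conjunct1[OF descends] conjunct2[OF descends])
  moreover have "poly_bracket \<beta> (f - f') g + poly_bracket \<beta> f' (g - g')
      = poly_bracket \<beta> f g - poly_bracket \<beta> f' g'" by simp
  ultimately have "poly_bracket \<beta> f g +o I = poly_bracket \<beta> f' g' +o I"
    by (simp add: coset_eq_iff[OF polyideal_subspace[OF I]])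
  then show ?thesis
    by (simp add: quot_bracket_def f'_def g'_def)
qed

lemma quot_bracket_poisson:
  assumes descends: "\<And>f g. f \<in> I \<Longrightarrow> poly_bracket \<beta> f g \<in> I \<and> poly_bracket \<beta> g f \<in> I"
    and anti: "\<And>v w. \<beta> v w + \<beta> w v \<in> I"
    and jac: "\<And>u v w. jacobiator \<beta> (pvar u) (pvar v) (pvar w) \<in> I"
  shows "poisson_bracket (quot_const I) (ring_of_type_algebra Quot I) (quot_bracket \<beta>)"
proof -
  let ?R = "ring_of_type_algebra Quot I"
  note [simp] = quot_bracket_coset[OF descends]
  note N = polyideal_subspace[OF I]
  have fn: "quot_bracket \<beta> \<in> carrier ?R \<rightarrow>\<^sub>E (carrier ?R \<rightarrow>\<^sub>E carrier ?R)"
    by (auto simp: quot_bracket_def)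
  have deriv: "derivation (quot_const I) ?R (\<lambda>g. quot_bracket \<beta> f g)"
    "derivation (quot_const I) ?R (\<lambda>g. quot_bracket \<beta> g f)" if "f \<in> carrier ?R" for f
  proof -
    from that obtain p where [simp]: "f = p +o I" by (auto simp: poly_quot_carrier)
    have [simp]: "poly_bracket \<beta> (Poly_Mapping.single 0 c) p = 0" "poly_bracket \<beta> p (Poly_Mapping.single 0 c) = 0" for c
      using poly_bracket_left(2)[of \<beta> c 1 p] poly_bracket_right(2)[of \<beta> p c 1]
      by (simp_all add: free_scale_eq_mult del: poly_bracket_left(2,3) poly_bracket_right(2,3))
    show "derivation (quot_const I) ?R (\<lambda>g. quot_bracket \<beta> f g)"
         "derivation (quot_const I) ?R (\<lambda>g. quot_bracket \<beta> g f)"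
      unfolding derivation_def poly_quot_carrier by (simp_all add: Pi_iff)
  qed
  have anti': "quot_bracket \<beta> f g = \<ominus>\<^bsub>?R\<^esub> quot_bracket \<beta> g f" if "f \<in> carrier ?R" "g \<in> carrier ?R" for f g
  proof -
    from that obtain p q where [simp]: "f = p +o I" "g = q +o I" by (auto simp: poly_quot_carrier)
    have "poly_bracket \<beta> p q + poly_bracket \<beta> q p \<in> I" by (rule poly_bracket_antisym[OF I anti])
    then show ?thesis by (simp add: coset_eq_iff[OF N])
  qed
  have jacobi: "quot_bracket \<beta> f (quot_bracket \<beta> g h) \<oplus>\<^bsub>?R\<^esub> quot_bracket \<beta> g (quot_bracket \<beta> h f)
    \<oplus>\<^bsub>?R\<^esub> quot_bracket \<beta> h (quot_bracket \<beta> f g) = \<zero>\<^bsub>?R\<^esub>"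
    if "f \<in> carrier ?R" "g \<in> carrier ?R" "h \<in> carrier ?R" for f g h
  proof -
    from that obtain p q r where [simp]: "f = p +o I" "g = q +o I" "h = r +o I"
      by (auto simp: poly_quot_carrier)
    have "jacobiator \<beta> p q r \<in> I" by (rule jacobiator_in_ideal[OF I anti jac])
    then show ?thesis by (simp add: poly_quot_zero coset_eq_subspace_iff[OF N] jacobiator_def)
  qed
  show ?thesis
    unfolding poisson_bracket_def antisym_biderivation_def
    by (intro conjI ballI fn deriv anti' jacobi)
qed

end

section \<open>Tensor powers\<close>

lemma subspace_rel2: "free.subspace (rel2 scale)"
  by (simp add: rel2_def)

lemma subspace_rel3: "free.subspace (rel3 scale)"
  by (simp add: rel3_def)

text \<open>The universal property of the tensor square, with bilinearity required only modulo a subspace.\<close>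

lemma linear_ext_rel2:
  assumes N: "free.subspace N"
    and "\<And>a a' b. h (a + a', b) - h (a, b) - h (a', b) \<in> N"
    and "\<And>a b b'. h (a, b + b') - h (a, b) - h (a, b') \<in> N"
    and "\<And>c a b. h (scale c a, b) - free_scale c (h (a, b)) \<in> N"
    and "\<And>c a b. h (a, scale c b) - free_scale c (h (a, b)) \<in> N"
    and r: "r \<in> rel2 scale"
  shows "linear_ext h r \<in> N"
  using N _ r[unfolded rel2_def] by (rule linear_ext_span_subset) (use assms(2-5) in auto)

lemma linear_ext_rel3:
  assumes N: "free.subspace N"
    and "\<And>a a' b c. h (a + a', b, c) - h (a, b, c) - h (a', b, c) \<in> N"
    and "\<And>a b b' c. h (a, b + b', c) - h (a, b, c) - h (a, b', c) \<in> N"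
    and "\<And>a b c c'. h (a, b, c + c') - h (a, b, c) - h (a, b, c') \<in> N"
    and "\<And>s a b c. h (scale s a, b, c) - free_scale s (h (a, b, c)) \<in> N"
    and "\<And>s a b c. h (a, scale s b, c) - free_scale s (h (a, b, c)) \<in> N"
    and "\<And>s a b c. h (a, b, scale s c) - free_scale s (h (a, b, c)) \<in> N"
    and r: "r \<in> rel3 scale"
  shows "linear_ext h r \<in> N"
  using N _ r[unfolded rel3_def] by (rule linear_ext_span_subset) (use assms(2-7) in auto)

lemma rel2_relations:
  shows "Poly_Mapping.single (a + a', b) 1 - Poly_Mapping.single (a, b) 1
         - Poly_Mapping.single (a', b) 1 \<in> rel2 scale"
    and "Poly_Mapping.single (a, b + b') 1 - Poly_Mapping.single (a, b) 1
         - Poly_Mapping.single (a, b') 1 \<in> rel2 scale"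
    and "Poly_Mapping.single (scale c a, b) 1 - Poly_Mapping.single (a, b) c \<in> rel2 scale"
    and "Poly_Mapping.single (a, scale c b) 1 - Poly_Mapping.single (a, b) c \<in> rel2 scale"
  unfolding rel2_def by (rule free.span_base, unfold Un_iff mem_Collect_eq, blast)+

lemma rel3_relations:
  shows "Poly_Mapping.single (a + a', b, c) 1 - Poly_Mapping.single (a, b, c) 1
         - Poly_Mapping.single (a', b, c) 1 \<in> rel3 scale"
    and "Poly_Mapping.single (a, b + b', c) 1 - Poly_Mapping.single (a, b, c) 1
         - Poly_Mapping.single (a, b', c) 1 \<in> rel3 scale"
    and "Poly_Mapping.single (a, b, c + c') 1 - Poly_Mapping.single (a, b, c) 1
         - Poly_Mapping.single (a, b, c') 1 \<in> rel3 scale"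
    and "Poly_Mapping.single (scale s a, b, c) 1 - Poly_Mapping.single (a, b, c) s \<in> rel3 scale"
    and "Poly_Mapping.single (a, scale s b, c) 1 - Poly_Mapping.single (a, b, c) s \<in> rel3 scale"
    and "Poly_Mapping.single (a, b, scale s c) 1 - Poly_Mapping.single (a, b, c) s \<in> rel3 scale"
  unfolding rel3_def
  \<comment> \<open>The union of the six families nests to the left: the number of first injections selects one.\<close>
       apply (rule free.span_base, (rule UnI1)+, blast)
      apply (rule free.span_base, rule UnI1, rule UnI1, rule UnI1, rule UnI1, rule UnI2, blast)
     apply (rule free.span_base, rule UnI1, rule UnI1, rule UnI1, rule UnI2, blast)
    apply (rule free.span_base, rule UnI1, rule UnI1, rule UnI2, blast)
   apply (rule free.span_base, rule UnI1, rule UnI2, blast)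
  apply (rule free.span_base, rule UnI2, blast)
  done

lemma swap2_coset:
  "swap2 scale (u +o rel2 scale) = linear_ext (\<lambda>(x, y). Poly_Mapping.single (y, x) 1) u +o rel2 scale"
  unfolding swap2_def
proof (rule lin_extend_coset[OF subspace_rel2 subspace_rel2])
  fix r assume "r \<in> rel2 scale"
  then show "linear_ext (\<lambda>(x, y). Poly_Mapping.single (y, x) 1) r \<in> rel2 scale"
    by (rule linear_ext_rel2[OF subspace_rel2, rotated -1]) (auto simp: rel2_relations)
qed (auto simp: tens2_def)

definition perm_123 :: "('a \<times> 'a \<times> 'a \<Rightarrow>\<^sub>0 'k::field) \<Rightarrow> ('a \<times> 'a \<times> 'a \<Rightarrow>\<^sub>0 'k)" where
  "perm_123 = linear_ext (\<lambda>(x, y, z). Poly_Mapping.single (z, x, y) 1)"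

definition perm_132 :: "('a \<times> 'a \<times> 'a \<Rightarrow>\<^sub>0 'k::field) \<Rightarrow> ('a \<times> 'a \<times> 'a \<Rightarrow>\<^sub>0 'k)" where
  "perm_132 = linear_ext (\<lambda>(x, y, z). Poly_Mapping.single (y, z, x) 1)"

definition perm_12 :: "('a \<times> 'a \<times> 'a \<Rightarrow>\<^sub>0 'k::field) \<Rightarrow> ('a \<times> 'a \<times> 'a \<Rightarrow>\<^sub>0 'k)" where
  "perm_12 = linear_ext (\<lambda>(x, y, z). Poly_Mapping.single (y, x, z) 1)"

lemma tau3_123_coset:
  "tau3 scale (cycle_of_list [1, 2, 3]) (w +o rel3 scale) = perm_123 w +o rel3 scale"
  unfolding tau3_def perm_123_def
proof (rule lin_extend_coset[OF subspace_rel3 subspace_rel3])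
  fix r assume "r \<in> rel3 scale"
  then show "linear_ext (\<lambda>(x, y, z). Poly_Mapping.single (z, x, y) 1) r \<in> rel3 scale"
    by (rule linear_ext_rel3[OF subspace_rel3, rotated -1]) (auto simp: rel3_relations)
qed (auto simp: tens3_def o_inv_distrib Let_def transpose_def)

lemma tau3_132_coset:
  "tau3 scale (cycle_of_list [1, 3, 2]) (w +o rel3 scale) = perm_132 w +o rel3 scale"
  unfolding tau3_def perm_132_def
proof (rule lin_extend_coset[OF subspace_rel3 subspace_rel3])
  fix r assume "r \<in> rel3 scale"
  then show "linear_ext (\<lambda>(x, y, z). Poly_Mapping.single (y, z, x) 1) r \<in> rel3 scale"
    by (rule linear_ext_rel3[OF subspace_rel3, rotated -1]) (auto simp: rel3_relations)
qed (auto simp: tens3_def o_inv_distrib Let_def transpose_def)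

lemma tau3_12_coset:
  "tau3 scale (cycle_of_list [1, 2]) (w +o rel3 scale) = perm_12 w +o rel3 scale"
  unfolding tau3_def perm_12_def
proof (rule lin_extend_coset[OF subspace_rel3 subspace_rel3])
  fix r assume "r \<in> rel3 scale"
  then show "linear_ext (\<lambda>(x, y, z). Poly_Mapping.single (y, x, z) 1) r \<in> rel3 scale"
    by (rule linear_ext_rel3[OF subspace_rel3, rotated -1]) (auto simp: rel3_relations)
qed (auto simp: tens3_def o_inv_distrib Let_def transpose_def)

section \<open>Double brackets by representatives\<close>

text \<open>Double brackets are cosets of formal sums of pairs. Fixing one formal sum for each bracket turns
  their laws into congruences modulo the tensor relations.\<close>

locale algebra_with_double_bracket = k_algebra scale
  for scale :: "'k::field \<Rightarrow> 'a::{ring, monoid_mult} \<Rightarrow> 'a" +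
  fixes db :: "'a \<Rightarrow> 'a \<Rightarrow> ('a \<times> 'a \<Rightarrow>\<^sub>0 'k) set"
  assumes double_bracket: "double_bracket scale db"
begin

definition db_rep :: "'a \<Rightarrow> 'a \<Rightarrow> ('a \<times> 'a \<Rightarrow>\<^sub>0 'k)" where
  "db_rep a b = (SOME u. db a b = u +o rel2 scale)"

lemma double_bracket_laws:
  "db a b \<in> tensor2 scale"
  "db a (b + b') = db a b + db a b'"
  "db a (scale c b) = coset_scale (rel2 scale) c (db a b)"
  "db a b = uminus ` swap2 scale (db b a)"
  "db a (b * d) =
        lin_extend (rel2 scale) (\<lambda>(x, y). tens2 scale x (b * y)) (db a d)
      + lin_extend (rel2 scale) (\<lambda>(x, y). tens2 scale x (y * d)) (db a b)"
proof -
  note D = double_bracket[unfolded double_bracket_def]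
  note D3 = D[THEN conjunct2, THEN conjunct2]
  note D5 = D3[THEN conjunct2, THEN conjunct2]
  note D7 = D5[THEN conjunct2, THEN conjunct2]
  show "db a b \<in> tensor2 scale" using D[THEN conjunct1] by simp
  show "db a (b + b') = db a b + db a b'" using D3[THEN conjunct1] by simp
  show "db a (scale c b) = coset_scale (rel2 scale) c (db a b)" using D5[THEN conjunct1] by simp
  show "db a b = uminus ` swap2 scale (db b a)"
    by (rule D5[THEN conjunct2, THEN conjunct1, rule_format])
  show "db a (b * d) =
        lin_extend (rel2 scale) (\<lambda>(x, y). tens2 scale x (b * y)) (db a d)
      + lin_extend (rel2 scale) (\<lambda>(x, y). tens2 scale x (y * d)) (db a b)"
    by (rule D7[THEN conjunct1, rule_format])
qed

lemma db_coset: "db a b = db_rep a b +o rel2 scale"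
proof -
  have "db a b \<in> tensor2 scale"
    by (rule double_bracket_laws)
  then have "\<exists>u. db a b = u +o rel2 scale"
    by (auto simp: tensor2_def)
  then show ?thesis unfolding db_rep_def by (rule someI_ex)
qed

lemma db_rep_add: "db_rep a (b + b') - (db_rep a b + db_rep a b') \<in> rel2 scale"
proof -
  have "db a (b + b') = db a b + db a b'"
    by (rule double_bracket_laws)
  then show ?thesis
    by (simp add: db_coset coset_add[OF subspace_rel2] coset_eq_iff[OF subspace_rel2])
qed

lemma db_rep_scale: "db_rep a (scale c b) - free_scale c (db_rep a b) \<in> rel2 scale"
proof -
  have "db a (scale c b) = coset_scale (rel2 scale) c (db a b)"
    by (rule double_bracket_laws)
  then show ?thesis
    by (simp add: db_coset coset_scale_coset[OF subspace_rel2] coset_eq_iff[OF subspace_rel2])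
qed

lemma db_rep_antisym:
  "db_rep a b + linear_ext (\<lambda>(x, y). Poly_Mapping.single (y, x) 1) (db_rep b a) \<in> rel2 scale"
proof -
  have "db a b = uminus ` swap2 scale (db b a)"
    by (rule double_bracket_laws)
  then show ?thesis
    by (simp add: db_coset swap2_coset coset_uminus[OF subspace_rel2] coset_eq_iff[OF subspace_rel2])
qed

lemma db_rep_mult:
  "db_rep a (b * c) - (linear_ext (\<lambda>(x, y). Poly_Mapping.single (x, b * y) 1) (db_rep a c)
     + linear_ext (\<lambda>(x, y). Poly_Mapping.single (x, y * c) 1) (db_rep a b)) \<in> rel2 scale"
proof -
  have "lin_extend (rel2 scale) (\<lambda>(x, y). tens2 scale x (b * y)) (u +o rel2 scale)
      = linear_ext (\<lambda>(x, y). Poly_Mapping.single (x, b * y) 1) u +o rel2 scale" for b u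
  proof (rule lin_extend_coset[OF subspace_rel2 subspace_rel2])
    fix r assume "r \<in> rel2 scale"
    then show "linear_ext (\<lambda>(x, y). Poly_Mapping.single (x, b * y) 1) r \<in> rel2 scale"
      by (rule linear_ext_rel2[OF subspace_rel2, rotated -1])
        (auto simp: rel2_relations distrib_left scale_mult_right)
  qed (auto simp: tens2_def)
  moreover have "lin_extend (rel2 scale) (\<lambda>(x, y). tens2 scale x (y * c)) (u +o rel2 scale)
      = linear_ext (\<lambda>(x, y). Poly_Mapping.single (x, y * c) 1) u +o rel2 scale" for c u
  proof (rule lin_extend_coset[OF subspace_rel2 subspace_rel2])
    fix r assume "r \<in> rel2 scale"
    then show "linear_ext (\<lambda>(x, y). Poly_Mapping.single (x, y * c) 1) r \<in> rel2 scale"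
      by (rule linear_ext_rel2[OF subspace_rel2, rotated -1])
        (auto simp: rel2_relations distrib_right scale_mult_left)
  qed (auto simp: tens2_def)
  moreover have "db a (b * c) =
        lin_extend (rel2 scale) (\<lambda>(x, y). tens2 scale x (b * y)) (db a c)
      + lin_extend (rel2 scale) (\<lambda>(x, y). tens2 scale x (y * c)) (db a b)"
    by (rule double_bracket_laws)
  ultimately show ?thesis
    by (simp add: db_coset coset_add[OF subspace_rel2] coset_eq_iff[OF subspace_rel2])
qed

text \<open>The Leibniz rule for the product \<open>1 * 1\<close> expresses the bracket with \<open>1\<close> as twice itself.\<close>

lemma db_rep_one: "db_rep a 1 \<in> rel2 scale"
  using free.subspace_neg[OF subspace_rel2 db_rep_mult[of a 1 1]]
  by (simp add: case_prod_unfold linear_ext_basis)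

definition bracket_L_rep :: "'a \<Rightarrow> ('a \<times> 'a \<Rightarrow>\<^sub>0 'k) \<Rightarrow> ('a \<times> 'a \<times> 'a \<Rightarrow>\<^sub>0 'k)" where
  "bracket_L_rep a = linear_ext (\<lambda>(b1, b2). linear_ext (\<lambda>(x, y). Poly_Mapping.single (x, y, b2) 1) (db_rep a b1))"

text \<open>Independence of the representative \<open>u\<close> uses that the double bracket is linear in its second
  argument, into which the first tensor factor of \<open>u\<close> is inserted.\<close>

lemma bracket_L_coset: "bracket_L scale db a (u +o rel2 scale) = bracket_L_rep a u +o rel3 scale"
proof -
  let ?h = "\<lambda>b2. linear_ext (\<lambda>(x, y). Poly_Mapping.single (x, y, b2) 1) :: _ \<Rightarrow> ('a \<times> 'a \<times> 'a \<Rightarrow>\<^sub>0 'k)"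
  have rel: "?h b2 r \<in> rel3 scale" if "r \<in> rel2 scale" for b2 r
    using that by (rule linear_ext_rel2[OF subspace_rel3, rotated -1]) (auto simp: rel3_relations)
  have inner: "lin_extend (rel3 scale) (\<lambda>(x, y). tens3 scale x y b2) (v +o rel2 scale)
      = ?h b2 v +o rel3 scale" for b2 v
    by (rule lin_extend_coset[OF subspace_rel3 subspace_rel2]) (auto simp: tens3_def rel)
  show ?thesis
    unfolding bracket_L_def bracket_L_rep_def
  proof (rule lin_extend_coset[OF subspace_rel3 subspace_rel2])
    fix r assume "r \<in> rel2 scale"
    then show "linear_ext (\<lambda>(b1, b2). ?h b2 (db_rep a b1)) r \<in> rel3 scale"
    proof (rule linear_ext_rel2[OF subspace_rel3, rotated -1]; unfold prod.case)
      fix b b' c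
      show "?h c (db_rep a (b + b')) - ?h c (db_rep a b) - ?h c (db_rep a b') \<in> rel3 scale"
        using rel[OF db_rep_add[of a b b'], of c] by (simp add: algebra_simps)
      have "linear_ext (\<lambda>(x, y). Poly_Mapping.single (x, y, b + b') 1 - Poly_Mapping.single (x, y, b) 1
          - Poly_Mapping.single (x, y, b') 1) u \<in> rel3 scale" for u
        by (rule linear_ext_in_subspace[OF subspace_rel3]) (auto simp: rel3_relations)
      then show "?h (b + b') (db_rep a c) - ?h b (db_rep a c) - ?h b' (db_rep a c) \<in> rel3 scale"
        by (simp add: case_prod_unfold linear_ext_ptw_diff)
    next
      fix s b c
      show "?h c (db_rep a (scale s b)) - free_scale s (?h c (db_rep a b)) \<in> rel3 scale"
        using rel[OF db_rep_scale[of a s b], of c] by simp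
      have "linear_ext (\<lambda>(x, y). Poly_Mapping.single (x, y, scale s c) 1
          - free_scale s (Poly_Mapping.single (x, y, c) 1)) u \<in> rel3 scale" for u
        by (rule linear_ext_in_subspace[OF subspace_rel3]) (auto simp: rel3_relations)
      then show "?h (scale s c) (db_rep a b) - free_scale s (?h c (db_rep a b)) \<in> rel3 scale"
        by (simp add: case_prod_unfold linear_ext_ptw_diff linear_ext_ptw_scale del: free_scale_single)
    qed
  qed (auto simp: db_coset inner)
qed

definition double_jacobiator_rep :: "'a \<Rightarrow> 'a \<Rightarrow> 'a \<Rightarrow> ('a \<times> 'a \<times> 'a \<Rightarrow>\<^sub>0 'k)" where
  "double_jacobiator_rep a b c = bracket_L_rep a (db_rep b c)
     + perm_123 (bracket_L_rep b (db_rep c a)) + perm_132 (bracket_L_rep c (db_rep a b))"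

lemma double_jacobiator_coset: "double_jacobiator scale db a b c = double_jacobiator_rep a b c +o rel3 scale"
  by (simp add: double_jacobiator_def db_coset bracket_L_coset tau3_123_coset tau3_132_coset
      coset_add[OF subspace_rel3] double_jacobiator_rep_def del: cycle_of_list.simps One_nat_def)

lemma weak_double_jacobiator_coset:
  "weak_double_jacobiator scale db a b c
     = (double_jacobiator_rep a b c - perm_12 (double_jacobiator_rep b a c)) +o rel3 scale"
  by (simp add: weak_double_jacobiator_def double_jacobiator_coset tau3_12_coset
      coset_add[OF subspace_rel3] coset_uminus[OF subspace_rel3] del: cycle_of_list.simps One_nat_def)

section \<open>The representation algebra\<close>

abbreviation J :: "('a, 'n::finite, 'k) rep_poly set" where
  "J \<equiv> rep_ideal scale"

lemma poly_const_mult: "poly_const c * f = free_scale c f"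
  by (simp add: poly_const_def free_scale_eq_mult)

lemma poly_var_eq: "poly_var a i j = pvar (a, i, j)"
  by (simp add: poly_var_def pvar_def)

text \<open>The generators of the ideal, with products by constant polynomials written as scalar multiples, so
  that the rules for linear extension apply to them.\<close>

definition relations :: "('a, 'n::finite, 'k) rep_poly set" where
  "relations =
     {free_scale l (pvar (a, i, j)) + free_scale m (pvar (b, i, j))
         - pvar (scale l a + scale m b, i, j) | l m a b i j. True}
    \<union> {pvar (1, i, j) - (if i = j then 1 else 0) | i j. True}
    \<union> {pvar (a * b, i, j) - (\<Sum>k\<in>UNIV. pvar (a, i, k) * pvar (b, k, j)) | a b i j. True}"

lemma rep_ideal_eq: "J = Idl\<^bsub>ring_of_type_algebra\<^esub> relations"
  by (simp only: rep_ideal_def relations_def poly_const_mult poly_var_eq)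

lemma polyideal_J: "polyideal J"
  unfolding rep_ideal_eq by (rule polyideal_genideal)

lemmas J_closed = polyideal_closed[OF polyideal_J]
lemmas subspace_J = polyideal_subspace[OF polyideal_J]

lemma relations_in_J: "r \<in> relations \<Longrightarrow> r \<in> J"
  unfolding rep_ideal_eq by (rule subsetD[OF polyideal_gen_subset])

lemma pvar_linear:
  "free_scale l (pvar (a, p)) + free_scale m (pvar (b, p)) - pvar (scale l a + scale m b, p)
     \<in> (J :: ('a, 'n::finite, 'k) rep_poly set)"
  by (cases p, rule relations_in_J, unfold relations_def, rule UnI1, rule UnI1, blast)

lemma pvar_add: "pvar (a + b, p) - pvar (a, p) - pvar (b, p) \<in> (J :: ('a, 'n::finite, 'k) rep_poly set)"
  using J_closed(5)[OF pvar_linear[of 1 a p 1 b]] by (simp add: algebra_simps)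

lemma pvar_scale: "pvar (scale c a, p) - free_scale c (pvar (a, p)) \<in> (J :: ('a, 'n::finite, 'k) rep_poly set)"
  using J_closed(5)[OF pvar_linear[of c a p 0 a]] by (simp add: algebra_simps)

lemma pvar_mult: "pvar (a * b, i, j) - (\<Sum>k\<in>UNIV. pvar (a, i, k) * pvar (b, k, j))
    \<in> (J :: ('a, 'n::finite, 'k) rep_poly set)"
  by (rule relations_in_J, unfold relations_def, rule UnI2, blast)

text \<open>Evaluation of formal tensors: each factor is replaced by one entry of its generic matrix, at the
  index pairs \<open>p\<close>, \<open>q\<close> (and \<open>r\<close> below). Tensor relations evaluate into the ideal, since modulo the ideal
  an entry depends linearly on the algebra element.\<close>

definition ev2 :: "'n \<times> 'n \<Rightarrow> 'n \<times> 'n \<Rightarrow> ('a \<times> 'a \<Rightarrow>\<^sub>0 'k) \<Rightarrow> ('a, 'n::finite, 'k) rep_poly" where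
  "ev2 p q = linear_ext (\<lambda>(x, y). pvar (x, p) * pvar (y, q))"

definition ev3 :: "'n \<times> 'n \<Rightarrow> 'n \<times> 'n \<Rightarrow> 'n \<times> 'n \<Rightarrow> ('a \<times> 'a \<times> 'a \<Rightarrow>\<^sub>0 'k)
    \<Rightarrow> ('a, 'n::finite, 'k) rep_poly" where
  "ev3 p q r = linear_ext (\<lambda>(x, y, z). pvar (x, p) * pvar (y, q) * pvar (z, r))"

lemma ev2_rel2:
  assumes "u \<in> rel2 scale"
  shows "ev2 p q u \<in> J"
  unfolding ev2_def
proof (rule linear_ext_rel2[OF subspace_J _ _ _ _ assms]; unfold prod.case)
  fix a a' b
  show "pvar (a + a', p) * pvar (b, q) - pvar (a, p) * pvar (b, q) - pvar (a', p) * pvar (b, q) \<in> J"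
    using J_closed(4)[OF pvar_add, of a a' p "pvar (b, q)"] by (simp add: algebra_simps)
  show "pvar (b, p) * pvar (a + a', q) - pvar (b, p) * pvar (a, q) - pvar (b, p) * pvar (a', q) \<in> J"
    using J_closed(3)[OF pvar_add, of "pvar (b, p)" a a' q] by (simp add: algebra_simps)
next
  fix c a b
  show "pvar (scale c a, p) * pvar (b, q) - free_scale c (pvar (a, p) * pvar (b, q)) \<in> J"
    using J_closed(4)[OF pvar_scale, of c a p "pvar (b, q)"]
    by (simp add: algebra_simps free_scale_mult_left free_scale_mult_right)
  show "pvar (a, p) * pvar (scale c b, q) - free_scale c (pvar (a, p) * pvar (b, q)) \<in> J"
    using J_closed(3)[OF pvar_scale, of "pvar (a, p)" c b q]
    by (simp add: algebra_simps free_scale_mult_left free_scale_mult_right)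
qed

lemma ev3_rel3:
  assumes "u \<in> rel3 scale"
  shows "ev3 p q r u \<in> J"
  unfolding ev3_def
proof (rule linear_ext_rel3[OF subspace_J _ _ _ _ _ _ assms]; unfold prod.case)
  note simps = algebra_simps free_scale_mult_left free_scale_mult_right
  let ?X = "\<lambda>a p. pvar (a, p)"
  fix a a' b c
  show "?X (a + a') p * ?X b q * ?X c r - ?X a p * ?X b q * ?X c r - ?X a' p * ?X b q * ?X c r \<in> J"
    using J_closed(4)[OF pvar_add, of a a' p "?X b q * ?X c r"] by (simp add: simps)
  show "?X b p * ?X (a + a') q * ?X c r - ?X b p * ?X a q * ?X c r - ?X b p * ?X a' q * ?X c r \<in> J"
    using J_closed(4)[OF pvar_add, of a a' q "?X b p * ?X c r"] by (simp add: simps)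
  show "?X b p * ?X c q * ?X (a + a') r - ?X b p * ?X c q * ?X a r - ?X b p * ?X c q * ?X a' r \<in> J"
    using J_closed(4)[OF pvar_add, of a a' r "?X b p * ?X c q"] by (simp add: simps)
next
  note simps = algebra_simps free_scale_mult_left free_scale_mult_right
  let ?X = "\<lambda>a p. pvar (a, p)"
  fix s a b c
  show "?X (scale s a) p * ?X b q * ?X c r - free_scale s (?X a p * ?X b q * ?X c r) \<in> J"
    using J_closed(4)[OF pvar_scale, of s a p "?X b q * ?X c r"] by (simp add: simps)
  show "?X a p * ?X (scale s b) q * ?X c r - free_scale s (?X a p * ?X b q * ?X c r) \<in> J"
    using J_closed(4)[OF pvar_scale, of s b q "?X a p * ?X c r"] by (simp add: simps)
  show "?X a p * ?X b q * ?X (scale s c) r - free_scale s (?X a p * ?X b q * ?X c r) \<in> J"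
    using J_closed(4)[OF pvar_scale, of s c r "?X a p * ?X b q"] by (simp add: simps)
qed

lemma ev2_linear [simp]:
  "ev2 p q (u + v) = ev2 p q u + ev2 p q v" "ev2 p q (u - v) = ev2 p q u - ev2 p q v"
  "ev2 p q (free_scale c u) = free_scale c (ev2 p q u)"
  by (simp_all add: ev2_def)

lemma ev3_linear [simp]:
  "ev3 p q r (u + v) = ev3 p q r u + ev3 p q r v" "ev3 p q r (u - v) = ev3 p q r u - ev3 p q r v"
  by (simp_all add: ev3_def)

lemma ev2_swap: "ev2 p q (linear_ext (\<lambda>(x, y). Poly_Mapping.single (y, x) 1) u) = ev2 q p u"
  by (simp add: ev2_def linear_ext_linear_ext case_prod_unfold mult.commute)

lemma ev3_permute [simp]:
  "ev3 p q r (perm_123 w) = ev3 q r p w" "ev3 p q r (perm_132 w) = ev3 r p q w"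
  "ev3 p q r (perm_12 w) = ev3 q p r w"
  by (simp_all add: ev3_def perm_123_def perm_132_def perm_12_def linear_ext_linear_ext
      case_prod_unfold mult_ac)

section \<open>The bracket of matrix entries\<close>

definition gen_bracket :: "'a \<times> 'n \<times> 'n \<Rightarrow> 'a \<times> 'n \<times> 'n \<Rightarrow> ('a, 'n::finite, 'k) rep_poly" where
  "gen_bracket = (\<lambda>(a, p) (b, q). ev2 p q (db_rep a b))"

lemma gen_bracket_antisym: "gen_bracket v w + gen_bracket w v \<in> J"
  using ev2_rel2[OF db_rep_antisym]
  by (cases v; cases w) (simp add: gen_bracket_def ev2_swap)

text \<open>The Leibniz rule of the double bracket multiplies the second factor from the left by \<open>b\<close> and from
  the right by \<open>c\<close>. Since the entry at \<open>(k, l)\<close> is taken from that same factor, expanding the matrix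
  product yields the Leibniz rule for the entries of the matrix of \<open>b * c\<close>.\<close>

lemma gen_bracket_mult:
  "ev2 p (k, l) (db_rep a (b * c)) - (\<Sum>m\<in>UNIV. ev2 p (k, m) (db_rep a b) * pvar (c, m, l)
     + pvar (b, k, m) * ev2 p (m, l) (db_rep a c)) \<in> (J :: ('a, 'n::finite, 'k) rep_poly set)"
proof -
  let ?X = "\<lambda>a i j. pvar (a, i, j) :: ('a, 'n::finite, 'k) rep_poly"
  have left: "ev2 p (k, l) (linear_ext (\<lambda>(x, y). Poly_Mapping.single (x, b * y) 1) u)
      - (\<Sum>m\<in>UNIV. ?X b k m * ev2 p (m, l) u) \<in> J" for u
  proof -
    have "linear_ext (\<lambda>(x, y). pvar (x, p) * (?X (b * y) k l - (\<Sum>m\<in>UNIV. ?X b k m * ?X y m l))) u \<in> J"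
      by (rule linear_ext_in_subspace[OF subspace_J]) (auto intro!: J_closed(3) pvar_mult)
    also have "linear_ext (\<lambda>(x, y). pvar (x, p) * (?X (b * y) k l - (\<Sum>m\<in>UNIV. ?X b k m * ?X y m l))) u
       = ev2 p (k, l) (linear_ext (\<lambda>(x, y). Poly_Mapping.single (x, b * y) 1) u)
      - (\<Sum>m\<in>UNIV. ?X b k m * ev2 p (m, l) u)"
      by (simp add: ev2_def linear_ext_linear_ext case_prod_unfold linear_ext_mult_left
          right_diff_distrib linear_ext_ptw_diff
          sum_distrib_left linear_ext_ptw_sum mult_ac)
    finally show ?thesis .
  qed
  have right: "ev2 p (k, l) (linear_ext (\<lambda>(x, y). Poly_Mapping.single (x, y * c) 1) u)
      - (\<Sum>m\<in>UNIV. ev2 p (k, m) u * ?X c m l) \<in> J" for u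
  proof -
    have "linear_ext (\<lambda>(x, y). pvar (x, p) * (?X (y * c) k l - (\<Sum>m\<in>UNIV. ?X y k m * ?X c m l))) u \<in> J"
      by (rule linear_ext_in_subspace[OF subspace_J]) (auto intro!: J_closed(3) pvar_mult)
    also have "linear_ext (\<lambda>(x, y). pvar (x, p) * (?X (y * c) k l - (\<Sum>m\<in>UNIV. ?X y k m * ?X c m l))) u
       = ev2 p (k, l) (linear_ext (\<lambda>(x, y). Poly_Mapping.single (x, y * c) 1) u)
      - (\<Sum>m\<in>UNIV. ?X c m l * ev2 p (k, m) u)"
      by (simp add: ev2_def linear_ext_linear_ext case_prod_unfold linear_ext_mult_left
          right_diff_distrib linear_ext_ptw_diff
          sum_distrib_left linear_ext_ptw_sum mult_ac)
    finally show ?thesis by (simp add: mult.commute)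
  qed
  from J_closed(2)[OF ev2_rel2[OF db_rep_mult[of a b c], of p "(k, l)"]
      J_closed(2)[OF left[of "db_rep a c"] right[of "db_rep a b"]]]
  show ?thesis by (simp add: algebra_simps sum.distrib)
qed

text \<open>Linearity of the double bracket deals with the linear relations, its vanishing at \<open>1\<close> with the
  unit relations, and its Leibniz rule with the multiplicative ones.\<close>

lemma gen_bracket_relations:
  assumes "r \<in> relations"
  shows "poly_bracket gen_bracket (pvar v) r \<in> (J :: ('a, 'n::finite, 'k) rep_poly set)"
proof -
  obtain e p where v: "v = (e, p)" by (cases v)
  consider (linear) l a i j m b where
      "r = free_scale l (pvar (a, i, j)) + free_scale m (pvar (b, i, j)) - pvar (scale l a + scale m b, i, j)"
    | (one) i j where "r = pvar (1, i, j) - (if i = j then 1 else 0)"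
    | (mult) a b i j where "r = pvar (a * b, i, j) - (\<Sum>k\<in>UNIV. pvar (a, i, k) * pvar (b, k, j))"
    using assms unfolding relations_def by blast
  then show ?thesis
  proof cases
    case linear
    have "ev2 p (i, j) (db_rep e (scale l a + scale m b) - (db_rep e (scale l a) + db_rep e (scale m b))
      + (db_rep e (scale l a) - free_scale l (db_rep e a))
      + (db_rep e (scale m b) - free_scale m (db_rep e b))) \<in> J"
      by (intro ev2_rel2 free.subspace_add[OF subspace_rel2] db_rep_add db_rep_scale)
    from J_closed(5)[OF this] show ?thesis
      by (simp add: linear v gen_bracket_def algebra_simps)
  next
    case one
    then show ?thesis
      by (simp add: v gen_bracket_def ev2_rel2 db_rep_one)
  next
    case mult
    then show ?thesis
      using gen_bracket_mult[of p i j e a b] by (simp add: v gen_bracket_def poly_bracket_sum_right)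
  qed
qed

lemma gen_bracket_descends:
  assumes "f \<in> (J :: ('a, 'n::finite, 'k) rep_poly set)"
  shows "poly_bracket gen_bracket f g \<in> J \<and> poly_bracket gen_bracket g f \<in> J"
  using poly_bracket_descends[OF gen_bracket_antisym[unfolded rep_ideal_eq]
      gen_bracket_relations[unfolded rep_ideal_eq] assms[unfolded rep_ideal_eq]]
  unfolding rep_ideal_eq by blast

text \<open>The iterated bracket of three matrix entries. Differentiating the first tensor factor of the
  inner bracket gives the left extension of the double bracket. Differentiating the second factor
  gives the same expression for the inner bracket with exchanged factors, which by antisymmetry is
  the negative of the inner bracket with exchanged arguments.\<close>

lemma poly_bracket_pvar_ev2:
  "poly_bracket gen_bracket (pvar (a, p)) (ev2 q r (db_rep b c))
     - (ev3 p q r (bracket_L_rep a (db_rep b c)) - ev3 p r q (bracket_L_rep a (db_rep c b))) \<in> J"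
proof -
  \<comment> \<open>The terms of the Leibniz rule in which the second tensor factor is differentiated.\<close>
  define M where "M = linear_ext (\<lambda>(x, y). pvar (x, q) * ev2 p r (db_rep a y))"
  have "poly_bracket gen_bracket (pvar (a, p)) (ev2 q r u) = ev3 p q r (bracket_L_rep a u) + M u" for u
    by (simp add: ev2_def ev3_def bracket_L_rep_def M_def poly_bracket_linear_ext_right
        linear_ext_linear_ext case_prod_unfold gen_bracket_def
        linear_ext_ptw_add linear_ext_mult_left mult_ac)
  moreover have "ev3 p r q (bracket_L_rep a u) = M (linear_ext (\<lambda>(x, y). Poly_Mapping.single (y, x) 1) u)" for u
    by (simp add: ev2_def ev3_def bracket_L_rep_def M_def linear_ext_linear_ext
        case_prod_unfold linear_ext_mult_left mult_ac)
  moreover have "M u \<in> J" if "u \<in> rel2 scale" for u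
    unfolding M_def
  proof (rule linear_ext_rel2[OF subspace_J _ _ _ _ that]; unfold prod.case)
    fix b b' c
    show "pvar (b + b', q) * ev2 p r (db_rep a c) - pvar (b, q) * ev2 p r (db_rep a c)
        - pvar (b', q) * ev2 p r (db_rep a c) \<in> J"
      using J_closed(4)[OF pvar_add, of b b' q "ev2 p r (db_rep a c)"] by (simp add: algebra_simps)
    show "pvar (c, q) * ev2 p r (db_rep a (b + b')) - pvar (c, q) * ev2 p r (db_rep a b)
        - pvar (c, q) * ev2 p r (db_rep a b') \<in> J"
      using J_closed(3)[OF ev2_rel2[OF db_rep_add], of "pvar (c, q)" p r a b b']
      by (simp add: algebra_simps)
  next
    fix s b c
    show "pvar (scale s b, q) * ev2 p r (db_rep a c) - free_scale s (pvar (b, q) * ev2 p r (db_rep a c)) \<in> J"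
      using J_closed(4)[OF pvar_scale, of s b q "ev2 p r (db_rep a c)"]
      by (simp add: algebra_simps free_scale_mult_left free_scale_mult_right)
    show "pvar (b, q) * ev2 p r (db_rep a (scale s c)) - free_scale s (pvar (b, q) * ev2 p r (db_rep a c)) \<in> J"
      using J_closed(3)[OF ev2_rel2[OF db_rep_scale], of "pvar (b, q)" p r a s c]
      by (simp add: algebra_simps free_scale_mult_left free_scale_mult_right)
  qed
  from this[OF db_rep_antisym[of b c]]
  have "M (db_rep b c) + M (linear_ext (\<lambda>(x, y). Poly_Mapping.single (y, x) 1) (db_rep c b)) \<in> J"
    by (simp add: M_def)
  ultimately show ?thesis by simp
qed

text \<open>Each cyclic rotation of the arguments contributes two of the six terms of the weak double
  Jacobiator; evaluation turns the permutation of tensor factors into a permutation of \<open>p\<close>, \<open>q\<close>, \<open>r\<close>.\<close>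

lemma gen_bracket_jacobi:
  assumes "weak_poisson scale db"
  shows "jacobiator gen_bracket (pvar u) (pvar v) (pvar w) \<in> J"
proof -
  obtain a p b q c r where [simp]: "u = (a, p)" "v = (b, q)" "w = (c, r)" by (cases u; cases v; cases w)
  have "weak_double_jacobiator scale db a b c = rel3 scale"
    using assms by (simp add: weak_poisson_def)
  then have "double_jacobiator_rep a b c - perm_12 (double_jacobiator_rep b a c) \<in> rel3 scale"
    by (simp add: weak_double_jacobiator_coset coset_eq_subspace_iff[OF subspace_rel3])
  from ev3_rel3[OF this, of p q r]
  have "ev3 p q r (bracket_L_rep a (db_rep b c)) - ev3 p r q (bracket_L_rep a (db_rep c b))
      + (ev3 q r p (bracket_L_rep b (db_rep c a)) - ev3 q p r (bracket_L_rep b (db_rep a c)))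
      + (ev3 r p q (bracket_L_rep c (db_rep a b)) - ev3 r q p (bracket_L_rep c (db_rep b a))) \<in> J"
    by (simp add: double_jacobiator_rep_def algebra_simps)
  from J_closed(2)[OF J_closed(2)[OF J_closed(2)[OF poly_bracket_pvar_ev2[of a p q r b c]
        poly_bracket_pvar_ev2[of b q r p c a]] poly_bracket_pvar_ev2[of c r p q a b]] this]
  show ?thesis
    by (simp add: jacobiator_def gen_bracket_def algebra_simps)
qed

section \<open>Descent to trace functions\<close>

lemma rep_alg_eq: "rep_alg scale = ring_of_type_algebra Quot J"
  by (simp add: rep_alg_def)

lemma rep_const_eq: "rep_const scale = quot_const J"
  by (simp add: fun_eq_iff rep_const_def a_r_coset_type_algebra poly_const_def)

lemma rep_gen_eq: "rep_gen scale a i j = pvar (a, i, j) +o J"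
  by (simp add: rep_gen_def a_r_coset_type_algebra poly_var_eq)

lemma rep_trace_eq: "rep_trace scale a = (\<Sum>i\<in>UNIV. pvar (a, i, i)) +o J"
  by (simp add: rep_trace_def rep_alg_eq rep_gen_eq poly_quot_finsum[OF polyideal_J])

lemma rep_gen_mult:
  "rep_gen scale x i j \<otimes>\<^bsub>rep_alg scale\<^esub> rep_gen scale y k l = pvar (x, i, j) * pvar (y, k, l) +o J"
  unfolding rep_alg_eq rep_gen_eq by (rule poly_quot_mult[OF polyideal_J])

lemma generator_bracket_coset:
  "lin_extend J (\<lambda>(x, y). rep_gen scale x i j \<otimes>\<^bsub>rep_alg scale\<^esub> rep_gen scale y k l) (db a b)
     = gen_bracket (a, i, j) (b, k, l) +o J"
proof -
  have "lin_extend J (\<lambda>(x, y). rep_gen scale x i j \<otimes>\<^bsub>rep_alg scale\<^esub> rep_gen scale y k l)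
      (db_rep a b +o rel2 scale) = ev2 (i, j) (k, l) (db_rep a b) +o J"
    unfolding ev2_def
    by (rule lin_extend_coset[OF subspace_J subspace_rel2])
      (simp_all add: rep_gen_mult case_prod_unfold ev2_rel2[unfolded ev2_def case_prod_unfold])
  then show ?thesis by (simp add: gen_bracket_def db_coset)
qed

lemma rep_alg_cring: "cring (rep_alg scale)"
  unfolding rep_alg_eq by (rule poly_quot_cring[OF polyideal_J])

lemma rep_const_carrier: "rep_const scale c \<in> carrier (rep_alg scale)"
  and rep_trace_carrier: "rep_trace scale a \<in> carrier (rep_alg scale)"
  by (simp_all add: rep_alg_eq rep_const_eq rep_trace_eq poly_quot_mem[OF polyideal_J])

lemma trace_ring_subring: "subring (trace_ring scale) (rep_alg scale)"
  unfolding trace_ring_def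
  by (rule ring.generate_ring_is_subring[OF cring.axioms(1)[OF rep_alg_cring]])
    (auto simp: rep_const_carrier rep_trace_carrier)

lemma rep_const_trace_ring: "rep_const scale c \<in> trace_ring scale"
  and rep_trace_trace_ring: "rep_trace scale a \<in> trace_ring scale"
  unfolding trace_ring_def by (auto intro: generate_ring.incl)

text \<open>Makes the trace ring accessible to linear extension, so that a formal sum may be evaluated in it
  term by term.\<close>

lemma subspace_trace_ring: "free.subspace {f :: ('a, 'n::finite, 'k) rep_poly. f +o J \<in> trace_ring scale}"
proof -
  note cl = subringE[OF trace_ring_subring, unfolded rep_alg_eq]
  have "free_scale c f +o J \<in> trace_ring scale" if "f +o J \<in> trace_ring scale"
    for c and f :: "('a, 'n, 'k) rep_poly"
    using cl(6)[OF rep_const_trace_ring that, of c]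
    by (simp add: rep_const_eq poly_quot_scale[OF polyideal_J])
  moreover have "(f + g) +o J \<in> trace_ring scale"
    if "f +o J \<in> trace_ring scale" "g +o J \<in> trace_ring scale" for f g :: "('a, 'n, 'k) rep_poly"
    using cl(7)[OF that] by (simp add: poly_quot_add[OF polyideal_J])
  ultimately show ?thesis
    using cl(2) by (simp add: free.subspace_def poly_quot_zero[OF polyideal_J])
qed

text \<open>Summing \<open>{a\<^sub>i\<^sub>i, b\<^sub>k\<^sub>k} = d'\<^sub>i\<^sub>i d''\<^sub>k\<^sub>k\<close> over \<open>i\<close> and \<open>k\<close> gives \<open>tr d' tr d''\<close>.\<close>

lemma trace_bracket_trace_ring:
  "quot_bracket J gen_bracket (rep_trace scale a) (rep_trace scale b)
     \<in> (trace_ring scale :: ('a, 'n::finite, 'k) rep_poly set set)"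
proof -
  let ?tr = "\<lambda>x. \<Sum>i\<in>UNIV. pvar (x, i, i) :: ('a, 'n, 'k) rep_poly"
  note cl = subringE[OF trace_ring_subring, unfolded rep_alg_eq]
  have "(?tr x * ?tr y) +o J \<in> trace_ring scale" for x y
    using cl(6)[OF rep_trace_trace_ring rep_trace_trace_ring, of x y]
    by (simp add: rep_trace_eq poly_quot_mult[OF polyideal_J])
  then have "linear_ext (\<lambda>(x, y). ?tr x * ?tr y) (db_rep a b) \<in> {f. f +o J \<in> trace_ring scale}"
    by (intro linear_ext_in_subspace subspace_trace_ring) auto
  moreover have "poly_bracket gen_bracket (?tr a) (?tr b)
      = linear_ext (\<lambda>(x, y). ?tr x * ?tr y) (db_rep a b)"
    by (simp only: poly_bracket_sum_left) (simp add: poly_bracket_sum_right gen_bracket_def ev2_def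
        case_prod_unfold sum_product
        flip: linear_ext_ptw_sum)
  ultimately show ?thesis
    by (simp add: rep_trace_eq quot_bracket_coset[OF polyideal_J gen_bracket_descends])
qed

end

theorem theorem4p11:
  fixes scale :: "'k::field_char_0 \<Rightarrow> 'a::{ring, monoid_mult} \<Rightarrow> 'a"
    and db :: "'a \<Rightarrow> 'a \<Rightarrow> ('a \<times> 'a \<Rightarrow>\<^sub>0 'k) set"
  assumes "k_algebra scale"
    and "finitely_generated scale"
    and "weak_poisson scale db"
  shows "(\<exists>!br :: ('a, 'n::finite, 'k) rep_poly set \<Rightarrow> ('a, 'n, 'k) rep_poly set \<Rightarrow>
                   ('a, 'n, 'k) rep_poly set. induced_biderivation scale db br) \<and>
    (\<forall>br :: ('a, 'n, 'k) rep_poly set \<Rightarrow> ('a, 'n, 'k) rep_poly set \<Rightarrow> ('a, 'n, 'k) rep_poly set.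
       induced_biderivation scale db br \<longrightarrow>
         poisson_bracket (rep_const scale) (rep_alg scale) br \<and>
         poisson_bracket (rep_const scale) (rep_alg scale \<lparr>carrier := trace_ring scale\<rparr>)
           (\<lambda>f\<in>trace_ring scale. \<lambda>g\<in>trace_ring scale. br f g))"
proof -
  interpret algebra_with_double_bracket scale db
    using assms by (simp add: algebra_with_double_bracket_def algebra_with_double_bracket_axioms_def
        weak_poisson_def)
  let ?br = "quot_bracket J gen_bracket :: ('a, 'n, 'k) rep_poly set \<Rightarrow> ('a, 'n, 'k) rep_poly set \<Rightarrow>
     ('a, 'n, 'k) rep_poly set"
  have poisson: "poisson_bracket (rep_const scale) (rep_alg scale) ?br"
    unfolding rep_const_eq rep_alg_eq
    by (rule quot_bracket_poisson[OF polyideal_J gen_bracket_descends gen_bracket_antisym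
          gen_bracket_jacobi[OF assms(3)]])
  then have biderivation: "antisym_biderivation (rep_const scale) (rep_alg scale) ?br"
    by (simp add: poisson_bracket_def)
  have "?br (rep_gen scale a i j) (rep_gen scale b k l) = gen_bracket (a, i, j) (b, k, l) +o J"
    for a b i j k l
    by (simp add: rep_gen_eq quot_bracket_coset[OF polyideal_J gen_bracket_descends])
  with biderivation have induced: "induced_biderivation scale db ?br"
    unfolding induced_biderivation_def generator_bracket_coset by blast
  have unique: "br = ?br" if "induced_biderivation scale db br" for br
  proof (rule poly_quot_biderivation_unique[OF polyideal_J])
    show "antisym_biderivation (quot_const J) (ring_of_type_algebra Quot J) br"
      using that by (simp add: induced_biderivation_def rep_const_eq rep_alg_eq)
    show "antisym_biderivation (quot_const J) (ring_of_type_algebra Quot J) ?br"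
      using biderivation by (simp add: rep_const_eq rep_alg_eq)
    fix v w :: "'a \<times> 'n \<times> 'n"
    obtain a i j b k l where "v = (a, i, j)" "w = (b, k, l)" by (cases v; cases w)
    then show "br (pvar v +o J) (pvar w +o J) = ?br (pvar v +o J) (pvar w +o J)"
      using that induced by (simp add: induced_biderivation_def flip: rep_gen_eq)
  qed
  have "poisson_bracket (rep_const scale) (rep_alg scale \<lparr>carrier := trace_ring scale\<rparr>)
           (\<lambda>f\<in>trace_ring scale. \<lambda>g\<in>trace_ring scale. ?br f g)"
  proof (rule poisson_bracket_subring[OF rep_alg_cring poisson trace_ring_subring rep_const_trace_ring])
    fix f g :: "('a, 'n, 'k) rep_poly set"
    assume "f \<in> trace_ring scale" "g \<in> trace_ring scale"
    then show "?br f g \<in> trace_ring scale"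
      unfolding trace_ring_def
      by (rule generate_ring_biderivation_closed[OF rep_alg_cring biderivation, rotated -2])
        (auto simp: rep_const_carrier rep_trace_carrier trace_bracket_trace_ring[unfolded trace_ring_def])
  qed
  with poisson induced unique show ?thesis by blast
qed

end
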